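(* Let $\Lambda$ be a space with measure $\mu$. Suppose $K(x,y)$ is a quaternion kernel on $\Lambda$ that has a real diagonal form $K(x,y)=\sum_{k=1}^\infty\lambda_ku_k(x)u_k^*(y)$ with eigenvalues $\lambda_k$, that all $\lambda_k\in[0,1]$, and that $\sum_{k=1}^\infty\lambda_k<\infty$. Let $\xi_1,\xi_2,\ldots$ be independent Bernoulli random variables, where $\xi_k$ takes value $1$ with probability $\lambda_k$ and value $0$ with probability $1-\lambda_k$, and define the random kernel $$K_\xi(x,y)=\sum_{k=1}^\infty\xi_ku_k(x)u_k^*(y).$$ Let $\mathcal{X}_\xi$ be a random point field which is a mix of Pfaffian point fields with random kernels $K_\xi(x,y)$ (i.e. conditionally on $\xi=(\xi_k)$, $\mathcal{X}_\xi$ is a Pfaffian point field with kernel $K_\xi$). Then $\mathcal{X}_\xi$ is a Pfaffian point field with the kernel $K(x,y)$.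
   Context: Quaternions. "Quaternions" are complexified quaternions $q=s+x\mathbf{i}+y\mathbf{j}+z\mathbf{k}\in\mathbb{Q}_{\mathbb{C}}$ with $s,x,y,z\in\mathbb{C}$ (usual quaternion multiplication rules, complex scalars central); real quaternions are those with $s,x,y,z\in\mathbb{R}$. In both cases the conjugate is $q^{*}=s-x\mathbf{i}-y\mathbf{j}-z\mathbf{k}$ (the coefficients are not complex-conjugated). The dual $X^*$ of a quaternion matrix is given by $(X^* )_{lk}=(X_{kl})^*$; $X$ is self-dual if $X^*=X$. A quaternion kernel $K:\Lambda\times\Lambda\to\mathbb{Q}_{\mathbb{C}}$ is self-dual if $K(y,x)=K(x,y)^*$. Moore-Dyson determinant. For an $n\times n$ quaternion matrix $X$, write each permutation $\sigma\in S_n$ as a product of cycles $\sigma=(n_1i_2\ldots i_s)(n_2j_2\ldots j_t)\ldots(n_rk_2\ldots k_l)$ where $n_i$ is the largest element of its cycle and $n_1>n_2>\ldots>n_r$. Then $\mathrm{Det}_M(X)=\sum_{\sigma}(-1)^{n-r}\left(X_{n_1i_2}X_{i_2i_3}\ldots X_{i_sn_1}\right)\ldots\left(X_{n_rk_2}X_{k_2k_3}\ldots X_{k_ln_r}\right)$. It is scalar for self-dual $X$. Random point fields. A random point field on $\Lambda$ is a probability measure on the space of countable configurations of points of $\Lambda$ (with finitely many points in every compact subset). $\#(A)$ is the number of points in $A$. A locally integrable $R_k:\Lambda^k\to\mathbb{R}_+$ is the $k$-point correlation function with respect to $\mu$ if for all disjoint measurable $A_1,\ldots,A_m\subset\Lambda$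 and non-negative integers $k_i$ with $\sum k_i=k$: $\mathbb{E}\prod_{i=1}^m[\#(A_i)\cdots(\#(A_i)-k_i+1)]=\int_{A_1^{k_1}\times\cdots\times A_m^{k_m}}R_k\,d\mu(x_1)\cdots d\mu(x_k)$. Correlation functions are defined up to sets of measure $0$. The field is Pfaffian with kernel $K$ if $K$ is a self-dual quaternion kernel and $R_m(x_1,\ldots,x_m)=\mathrm{Det}_M(K(x_i,x_j))_{1\le i,j\le m}$ for all $m\ge1$. Real diagonal form. $K(x,y)=\sum_k\lambda_ku_k(x)u_k^*(y)$ (series assumed absolutely convergent almost everywhere; finite sums allowed) with $\lambda_k$ real and $u_k$ real quaternion functions that are orthonormal: $\int_\Lambda u_k^*(x)u_l(x)\,d\mu(x)=\delta_{kl}$. *)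

theory Defs
  imports "HOL-Probability.Probability" "HOL-Combinatorics.Cycles" "HOL-Combinatorics.Orbits"
begin

section \<open>Complexified quaternions\<close>

datatype cquat =
  CQuat (cq_s: complex) (cq_x: complex) (cq_y: complex) (cq_z: complex)

lemma cquat_eq_iff:
  "p = q \<longleftrightarrow> cq_s p = cq_s q \<and> cq_x p = cq_x q \<and> cq_y p = cq_y q \<and> cq_z p = cq_z q"
  by (cases p; cases q) auto

instantiation cquat :: ring_1
begin

definition "0 = CQuat 0 0 0 0"
definition "1 = CQuat 1 0 0 0"
definition "p + q = CQuat (cq_s p + cq_s q) (cq_x p + cq_x q) (cq_y p + cq_y q) (cq_z p + cq_z q)"
definition "p - q = CQuat (cq_s p - cq_s q) (cq_x p - cq_x q) (cq_y p - cq_y q) (cq_z p - cq_z q)"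
definition "- q = CQuat (- cq_s q) (- cq_x q) (- cq_y q) (- cq_z q)"
definition "p * q = CQuat
  (cq_s p * cq_s q - cq_x p * cq_x q - cq_y p * cq_y q - cq_z p * cq_z q)
  (cq_s p * cq_x q + cq_x p * cq_s q + cq_y p * cq_z q - cq_z p * cq_y q)
  (cq_s p * cq_y q - cq_x p * cq_z q + cq_y p * cq_s q + cq_z p * cq_x q)
  (cq_s p * cq_z q + cq_x p * cq_y q - cq_y p * cq_x q + cq_z p * cq_s q)"

instance
  by standard
    (simp_all add: cquat_eq_iff zero_cquat_def one_cquat_def plus_cquat_def minus_cquat_def
      uminus_cquat_def times_cquat_def algebra_simps)

end

lemma cq_simps [simp]:
  "cq_s 0 = 0" "cq_x 0 = 0" "cq_y 0 = 0" "cq_z 0 = 0"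
  "cq_s 1 = 1" "cq_x 1 = 0" "cq_y 1 = 0" "cq_z 1 = 0"
  "cq_s (p + q) = cq_s p + cq_s q" "cq_x (p + q) = cq_x p + cq_x q"
  "cq_y (p + q) = cq_y p + cq_y q" "cq_z (p + q) = cq_z p + cq_z q"
  "cq_s (p - q) = cq_s p - cq_s q" "cq_x (p - q) = cq_x p - cq_x q"
  "cq_y (p - q) = cq_y p - cq_y q" "cq_z (p - q) = cq_z p - cq_z q"
  "cq_s (- q) = - cq_s q" "cq_x (- q) = - cq_x q" "cq_y (- q) = - cq_y q" "cq_z (- q) = - cq_z q"
  by (simp_all add: zero_cquat_def one_cquat_def plus_cquat_def minus_cquat_def uminus_cquat_def)

instantiation cquat :: real_vector
begin

definition "r *\<^sub>R q = CQuat (r *\<^sub>R cq_s q) (r *\<^sub>R cq_x q) (r *\<^sub>R cq_y q) (r *\<^sub>R cq_z q)"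

instance
  by standard (simp_all add: cquat_eq_iff scaleR_cquat_def algebra_simps)

end

text \<open>The norm is the Euclidean norm on the eight real coordinates; it provides the topology,
  Borel sets and Bochner integral for quaternion-valued functions.\<close>

instantiation cquat :: real_inner
begin

definition "inner p q = inner (cq_s p) (cq_s q) + inner (cq_x p) (cq_x q)
  + inner (cq_y p) (cq_y q) + inner (cq_z p) (cq_z q)"
definition "norm (q :: cquat) = sqrt (inner q q)"
definition "sgn (q :: cquat) = q /\<^sub>R norm q"
definition "dist (p :: cquat) q = norm (p - q)"
definition [code del]: "(uniformity :: (cquat \<times> cquat) filter)
  = (INF e\<in>{0<..}. principal {(x, y). dist x y < e})"
definition [code del]: "open (U :: cquat set)
  \<longleftrightarrow> (\<forall>x\<in>U. eventually (\<lambda>(x', y). x' = x \<longrightarrow> y \<in> U) uniformity)"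

instance
proof
  fix p q r :: cquat and a :: real
  show "inner p q = inner q p" "inner (p + q) r = inner p r + inner q r"
    "inner (a *\<^sub>R p) q = a * inner p q"
    by (simp_all add: inner_cquat_def scaleR_cquat_def inner_commute algebra_simps)
  show "0 \<le> inner p p"
    by (simp add: inner_cquat_def)
  show "inner p p = 0 \<longleftrightarrow> p = 0"
    by (simp add: inner_cquat_def cquat_eq_iff add_nonneg_eq_0_iff)
qed (simp_all add: norm_cquat_def sgn_cquat_def dist_cquat_def uniformity_cquat_def open_cquat_def)

end

instance cquat :: real_algebra_1
  by standard (simp_all add: cquat_eq_iff scaleR_cquat_def times_cquat_def algebra_simps)

instantiation cquat :: euclidean_space
begin

definition "Basis = (\<lambda>b. CQuat b 0 0 0) ` Basis \<union> (\<lambda>b. CQuat 0 b 0 0) ` Basis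
  \<union> (\<lambda>b. CQuat 0 0 b 0) ` Basis \<union> (\<lambda>b. CQuat 0 0 0 b) ` Basis"

instance
proof
  fix p q :: cquat
  show "(Basis :: cquat set) \<noteq> {}" "finite (Basis :: cquat set)"
    by (simp_all add: Basis_cquat_def)
  show "inner p q = (if p = q then 1 else 0)" if "p \<in> Basis" "q \<in> Basis"
    using that unfolding Basis_cquat_def
    by (elim UnE imageE) (simp_all add: inner_cquat_def inner_Basis nonzero_Basis)
  show "(\<forall>u\<in>Basis. inner p u = 0) \<longleftrightarrow> p = 0"
    by (simp add: Basis_cquat_def inner_cquat_def cquat_eq_iff ball_Un euclidean_all_zero_iff)
qed

end

definition qconj :: "cquat \<Rightarrow> cquat" where
  "qconj q = CQuat (cq_s q) (- cq_x q) (- cq_y q) (- cq_z q)"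

definition real_quat :: "cquat \<Rightarrow> bool" where
  "real_quat q \<longleftrightarrow> cq_s q \<in> \<real> \<and> cq_x q \<in> \<real> \<and> cq_y q \<in> \<real> \<and> cq_z q \<in> \<real>"

definition self_dual_kernel :: "('a \<Rightarrow> 'a \<Rightarrow> cquat) \<Rightarrow> bool" where
  "self_dual_kernel K \<longleftrightarrow> (\<forall>x y. K y x = qconj (K x y))"


section \<open>The Moore-Dyson determinant\<close>

text \<open>The matrix indices are \<open>0, \<dots>, n - 1\<close>. Fixed points of \<open>\<sigma>\<close> count as cycles of length one.\<close>

definition cycle_leaders :: "nat \<Rightarrow> (nat \<Rightarrow> nat) \<Rightarrow> nat set" where
  "cycle_leaders n \<sigma> = {a \<in> {..<n}. \<forall>b\<in>orbit \<sigma> a. b \<le> a}"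

text \<open>\<open>Cycles.support \<sigma> a\<close> is the list \<open>[a, \<sigma> a, \<sigma> (\<sigma> a), \<dots>]\<close> running once through the cycle of \<open>a\<close>.\<close>

definition cycle_product :: "(nat \<Rightarrow> nat \<Rightarrow> cquat) \<Rightarrow> (nat \<Rightarrow> nat) \<Rightarrow> nat \<Rightarrow> cquat" where
  "cycle_product X \<sigma> a = prod_list (map (\<lambda>i. X i (\<sigma> i)) (support \<sigma> a))"

definition Det_M :: "nat \<Rightarrow> (nat \<Rightarrow> nat \<Rightarrow> cquat) \<Rightarrow> cquat" where
  "Det_M n X = (\<Sum>\<sigma> | \<sigma> permutes {..<n}.
     (- 1) ^ (n - card (cycle_leaders n \<sigma>)) *
     prod_list (map (cycle_product X \<sigma>) (rev (sorted_list_of_set (cycle_leaders n \<sigma>)))))"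


section \<open>Random point fields\<close>

text \<open>A configuration is given by its multiplicity function, so that multiple points are not
  excluded a priori; configurations without multiple points are those with values in \<open>{0, 1}\<close>.\<close>

definition configurations :: "('a :: t2_space \<Rightarrow> nat) set" where
  "configurations = {c. countable {x. c x \<noteq> 0} \<and> (\<forall>C. compact C \<longrightarrow> finite {x \<in> C. c x \<noteq> 0})}"

definition num_points :: "('a \<Rightarrow> nat) \<Rightarrow> 'a set \<Rightarrow> ennreal" where
  "num_points c A = (\<integral>\<^sup>+x. of_nat (c x) \<partial>count_space A)"

definition config_space :: "('a :: t2_space \<Rightarrow> nat) measure" where
  "config_space = sigma configurations
     {{c \<in> configurations. num_points c A = of_nat n} | A n. A \<in> sets borel}"

definition random_point_field :: "('a :: t2_space \<Rightarrow> nat) measure \<Rightarrow> bool" where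
  "random_point_field P \<longleftrightarrow> prob_space P \<and> sets P = sets config_space"

text \<open>A function on \<open>\<Lambda>\<^sup>k\<close> takes its arguments as a point of the product space over \<open>{..<k}\<close>.
  Its local integrability is tested on the sets \<open>C\<^sup>k\<close> with \<open>C\<close> compact, which contain every
  compact subset of \<open>\<Lambda>\<^sup>k\<close>. The coordinates with indices \<open>k\<^sub>0 + \<dots> + k\<^sub>i\<^sub>-\<^sub>1 + j\<close>, \<open>j < k\<^sub>i\<close>,
  are the ones that range over \<open>A\<^sub>i\<close>.

  Expectations are taken in \<open>[0, \<infinity>]\<close>. The subtraction of \<open>ennreal\<close> is truncated and
  \<open>\<infinity> - j = \<infinity>\<close>, so the inner product is the falling factorial of \<open>#(A\<^sub>i)\<close> of order \<open>k\<^sub>i\<close>.\<close>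

definition correlation_function ::
  "('a :: t2_space) measure \<Rightarrow> ('a \<Rightarrow> nat) measure \<Rightarrow> nat \<Rightarrow> ((nat \<Rightarrow> 'a) \<Rightarrow> real) \<Rightarrow> bool" where
  "correlation_function \<mu> P k R \<longleftrightarrow>
     R \<in> borel_measurable (Pi\<^sub>M {..<k} (\<lambda>_. \<mu>)) \<and>
     (\<forall>x \<in> space (Pi\<^sub>M {..<k} (\<lambda>_. \<mu>)). 0 \<le> R x) \<and>
     (\<forall>C. compact C \<longrightarrow> set_integrable (Pi\<^sub>M {..<k} (\<lambda>_. \<mu>)) (PiE {..<k} (\<lambda>_. C)) R) \<and>
     (\<forall>(m :: nat) A ks. (\<forall>i<m. A i \<in> sets \<mu>) \<and> disjoint_family_on A {..<m} \<and> (\<Sum>i<m. ks i) = k \<longrightarrow>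
        (\<integral>\<^sup>+c. (\<Prod>i<m. \<Prod>j<ks i. num_points c (A i) - of_nat j) \<partial>P) =
        (\<integral>\<^sup>+x \<in> {x \<in> space (Pi\<^sub>M {..<k} (\<lambda>_. \<mu>)). \<forall>i<m. \<forall>j<ks i. x ((\<Sum>l<i. ks l) + j) \<in> A i}.
           ennreal (R x) \<partial>Pi\<^sub>M {..<k} (\<lambda>_. \<mu>)))"

text \<open>Correlation functions are only determined up to sets of measure zero, so \<open>R\<^sub>m = Det\<^sub>M\<close> is an
  equality almost everywhere; a real number is identified with the corresponding scalar quaternion.\<close>

definition pfaffian_field ::
  "('a :: t2_space) measure \<Rightarrow> ('a \<Rightarrow> nat) measure \<Rightarrow> ('a \<Rightarrow> 'a \<Rightarrow> cquat) \<Rightarrow> bool" where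
  "pfaffian_field \<mu> P K \<longleftrightarrow>
     random_point_field P \<and> self_dual_kernel K \<and>
     (\<forall>m\<ge>1. \<exists>R. correlation_function \<mu> P m R \<and>
        (AE x in Pi\<^sub>M {..<m} (\<lambda>_. \<mu>). of_real (R x) = Det_M m (\<lambda>i j. K (x i) (x j))))"


section \<open>Real diagonal form\<close>

text \<open>The index set \<open>I\<close> is \<open>UNIV\<close> for a genuine series and for example \<open>{..<n}\<close> for a finite sum.
  A divergent series has the value 0.\<close>

definition diagonal_kernel ::
  "nat set \<Rightarrow> (nat \<Rightarrow> real) \<Rightarrow> (nat \<Rightarrow> 'a \<Rightarrow> cquat) \<Rightarrow> 'a \<Rightarrow> 'a \<Rightarrow> cquat" where
  "diagonal_kernel I c u x y = (\<Sum>\<^sub>\<infinity>k\<in>I. c k *\<^sub>R (u k x * qconj (u k y)))"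

text \<open>The null set in the convergence condition is taken in \<open>\<Lambda>\<close>, not in \<open>\<Lambda> \<times> \<Lambda>\<close>: the values
  \<open>K(x, x)\<close> enter the correlation functions although the diagonal may be a null set.\<close>

definition real_diagonal_form ::
  "'a measure \<Rightarrow> nat set \<Rightarrow> (nat \<Rightarrow> real) \<Rightarrow> (nat \<Rightarrow> 'a \<Rightarrow> cquat) \<Rightarrow> ('a \<Rightarrow> 'a \<Rightarrow> cquat) \<Rightarrow> bool" where
  "real_diagonal_form \<mu> I lam u K \<longleftrightarrow>
     (\<forall>k\<in>I. u k \<in> borel_measurable \<mu> \<and> (\<forall>x. real_quat (u k x))) \<and>
     (\<forall>k\<in>I. \<forall>l\<in>I. has_bochner_integral \<mu> (\<lambda>x. qconj (u k x) * u l x) (if k = l then 1 else 0)) \<and>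
     (\<exists>N\<in>null_sets \<mu>. \<forall>x. \<forall>y. x \<notin> N \<longrightarrow> y \<notin> N \<longrightarrow>
        (\<lambda>k. norm (lam k *\<^sub>R (u k x * qconj (u k y)))) summable_on I) \<and>
     (\<forall>x y. K x y = diagonal_kernel I lam u x y)"

end

theory Submission
  imports Defs
begin

text \<open>
  The Moore-Dyson determinant of the real self-dual matrix \<open>\<Sum>\<^sub>k c\<^sub>k v\<^sub>k v\<^sub>k\<^sup>*\<close> is affine in every
  coefficient \<open>c\<^sub>k\<close>. For finitely many terms, independence therefore allows to replace the
  Bernoulli variables \<open>\<xi>\<^sub>k\<close> by their means \<open>\<lambda>\<^sub>k\<close> when the expectation of the determinant is taken.
  The determinant is also nonnegative for \<open>c \<ge> 0\<close>, so it increases with the number of terms, and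
  monotone convergence extends the identity to the infinite series. Tonelli's theorem then identifies the
  correlation functions of the mixture, and Hadamard's inequality makes them integrable.

  Multi-affinity and positivity both come from a Schur complement formula. That formula follows from
  invariance under row and column operations, i.e. from the vanishing of the bordered determinant whose
  border repeats an existing row. In the cycle expansion this vanishing holds because the sum over all
  closed walks through a point is invariant under reversal of the walk, hence scalar, so that splitting a
  cycle at a repeated row is compensated by the permutation with one cycle more.
\<close>

section \<open>Quaternions\<close>

definition qre :: "cquat \<Rightarrow> real" where "qre q = Re (cq_s q)"

lemma cq_scaleR [simp]:
  "cq_s (r *\<^sub>R q) = r *\<^sub>R cq_s q" "cq_x (r *\<^sub>R q) = r *\<^sub>R cq_x q"
  "cq_y (r *\<^sub>R q) = r *\<^sub>R cq_y q" "cq_z (r *\<^sub>R q) = r *\<^sub>R cq_z q"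
  by (simp_all add: scaleR_cquat_def)

lemma cq_of_real [simp]:
  "cq_s (of_real r) = of_real r" "cq_x (of_real r) = 0" "cq_y (of_real r) = 0" "cq_z (of_real r) = 0"
  by (simp_all add: of_real_def[where 'a = cquat]) (simp add: scaleR_conv_of_real)

lemma cq_times:
  "cq_s (p * q) = cq_s p * cq_s q - cq_x p * cq_x q - cq_y p * cq_y q - cq_z p * cq_z q"
  "cq_x (p * q) = cq_s p * cq_x q + cq_x p * cq_s q + cq_y p * cq_z q - cq_z p * cq_y q"
  "cq_y (p * q) = cq_s p * cq_y q - cq_x p * cq_z q + cq_y p * cq_s q + cq_z p * cq_x q"
  "cq_z (p * q) = cq_s p * cq_z q + cq_x p * cq_y q - cq_y p * cq_x q + cq_z p * cq_s q"
  by (simp_all add: times_cquat_def)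

lemma cq_qconj [simp]:
  "cq_s (qconj q) = cq_s q" "cq_x (qconj q) = - cq_x q"
  "cq_y (qconj q) = - cq_y q" "cq_z (qconj q) = - cq_z q"
  by (simp_all add: qconj_def)

lemma qconj_simps [simp]:
  "qconj 0 = 0" "qconj (p + q) = qconj p + qconj q" "qconj (p - q) = qconj p - qconj q"
  "qconj (- p) = - qconj p"
  "qconj (r *\<^sub>R p) = r *\<^sub>R qconj p" "qconj (qconj p) = p" "qconj (of_real r) = of_real r"
  by (simp_all add: cquat_eq_iff)

lemma qconj_mult: "qconj (p * q) = qconj q * qconj p"
  by (simp add: cquat_eq_iff cq_times algebra_simps)

lemma qconj_sum: "qconj (\<Sum>i\<in>A. f i) = (\<Sum>i\<in>A. qconj (f i))"
  by (induction A rule: infinite_finite_induct) auto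

lemma qre_simps [simp]:
  "qre 0 = 0" "qre (p + q) = qre p + qre q" "qre (p - q) = qre p - qre q"
  "qre (r *\<^sub>R p) = r * qre p" "qre (of_real r) = r" "qre (qconj p) = qre p"
  by (simp_all add: qre_def)

lemma qre_sum: "qre (\<Sum>i\<in>A. f i) = (\<Sum>i\<in>A. qre (f i))"
  by (induction A rule: infinite_finite_induct) auto

lemma qre_commute: "qre (p * q) = qre (q * p)"
  by (simp add: qre_def cq_times algebra_simps)

lemma real_quat_iff:
  "real_quat q \<longleftrightarrow> Im (cq_s q) = 0 \<and> Im (cq_x q) = 0 \<and> Im (cq_y q) = 0 \<and> Im (cq_z q) = 0"
  by (simp add: real_quat_def complex_is_Real_iff)

lemma real_quat_intros [simp]:
  "real_quat 0" "real_quat p \<Longrightarrow> real_quat q \<Longrightarrow> real_quat (p + q)"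
  "real_quat p \<Longrightarrow> real_quat q \<Longrightarrow> real_quat (p - q)"
  "real_quat p \<Longrightarrow> real_quat q \<Longrightarrow> real_quat (p * q)"
  "real_quat p \<Longrightarrow> real_quat (r *\<^sub>R p)" "real_quat p \<Longrightarrow> real_quat (qconj p)"
  "real_quat p \<Longrightarrow> real_quat (- p)" "real_quat (of_real r)"
  by (simp_all add: real_quat_iff cq_times)

lemma real_quat_sum: "(\<And>i. i \<in> A \<Longrightarrow> real_quat (f i)) \<Longrightarrow> real_quat (\<Sum>i\<in>A. f i)"
  by (induction A rule: infinite_finite_induct) auto

lemma add_qconj: "real_quat q \<Longrightarrow> q + qconj q = (2 * qre q) *\<^sub>R 1"
  by (simp add: cquat_eq_iff real_quat_iff qre_def complex_eq_iff)

lemma real_quat_selfdual: "real_quat q \<Longrightarrow> qconj q = q \<Longrightarrow> q = of_real (qre q)"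
  by (auto simp: cquat_eq_iff real_quat_iff qre_def complex_eq_iff)

lemma qre_mult_qconj: "real_quat q \<Longrightarrow> qre (q * qconj q) = (norm q)\<^sup>2"
  by (simp add: norm_cquat_def inner_cquat_def qre_def cq_times real_quat_iff inner_complex_def)

lemma mult_qconj: "real_quat q \<Longrightarrow> q * qconj q = of_real ((norm q)\<^sup>2)"
  using real_quat_selfdual[of "q * qconj q"] by (simp add: qconj_mult qre_mult_qconj)

section \<open>The cycle expansion\<close>

text \<open>A cycle through a point \<open>a\<close> outside \<open>S\<close> is encoded by the list
  of its other points in the order in which they are visited.\<close>

definition dlists :: "'a set \<Rightarrow> 'a list set" where
  "dlists S = {l. distinct l \<and> set l \<subseteq> S}"

lemma finite_dlists [simp]: "finite S \<Longrightarrow> finite (dlists S)"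
  using finite_subset_distinct[of S] by (simp add: dlists_def conj_commute)

lemma Nil_in_dlists [simp]: "[] \<in> dlists S"
  by (simp add: dlists_def)

lemma rev_dlists: "rev l \<in> dlists S \<longleftrightarrow> l \<in> dlists S"
  by (simp add: dlists_def)

lemma dlists_subset: "l \<in> dlists S \<Longrightarrow> set l \<subseteq> S"
  by (simp add: dlists_def)

lemma sum_dlists_rev: "(\<Sum>l\<in>dlists S. f l) = (\<Sum>l\<in>dlists S. f (rev l))"
  by (rule sum.reindex_bij_witness[of _ rev rev]) (auto simp: rev_dlists)

text \<open>A duplicate-free list either avoids \<open>b\<close> or splits uniquely at its only
  occurrence of \<open>b\<close>.\<close>

lemma sum_dlists_insert:
  fixes f :: "'a list \<Rightarrow> 'b::ab_group_add"
  assumes "finite S" "b \<notin> S"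
  shows "(\<Sum>l\<in>dlists (insert b S). f l) =
    (\<Sum>l\<in>dlists S. f l) + (\<Sum>l1\<in>dlists S. \<Sum>l2\<in>dlists (S - set l1). f (l1 @ b # l2))"
proof -
  define g where "g = (\<lambda>(l1, l2). l1 @ b # l2)"
  let ?P = "SIGMA l1:dlists S. dlists (S - set l1)"
  have inj: "inj_on g ?P"
  proof (rule inj_onI)
    fix p q assume pq: "p \<in> ?P" "q \<in> ?P" "g p = g q"
    obtain a a' c c' where [simp]: "p = (a, a')" "q = (c, c')" by (cases p; cases q)
    have "b \<notin> set a" "b \<notin> set c" "b \<notin> set a'" "b \<notin> set c'"
      using pq assms by (auto simp: dlists_def)
    then show "p = q"
      using pq by (auto simp: g_def append_Cons_eq_iff)
  qed
  have eq: "dlists (insert b S) = dlists S \<union> g ` ?P"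
  proof (intro equalityI subsetI)
    fix l assume l: "l \<in> dlists (insert b S)"
    show "l \<in> dlists S \<union> g ` ?P"
    proof (cases "b \<in> set l")
      case True
      then obtain l1 l2 where "l = l1 @ b # l2" by (meson split_list)
      with l have "(l1, l2) \<in> ?P" "l = g (l1, l2)"
        by (auto simp: dlists_def g_def)
      then show ?thesis by blast
    qed (use l in \<open>auto simp: dlists_def\<close>)
  qed (use assms in \<open>auto simp: dlists_def g_def\<close>)
  have fin: "finite ?P" using assms by auto
  have "(\<Sum>l\<in>dlists (insert b S). f l) = (\<Sum>l\<in>dlists S. f l) + (\<Sum>l\<in>g ` ?P. f l)"
    unfolding eq using assms fin
    by (intro sum.union_disjoint finite_dlists finite_imageI) (auto simp: dlists_def g_def)
  also have "(\<Sum>l\<in>g ` ?P. f l) = (\<Sum>p\<in>?P. f (g p))"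
    by (simp add: sum.reindex[OF inj])
  also have "\<dots> = (\<Sum>l1\<in>dlists S. \<Sum>l2\<in>dlists (S - set l1). f (l1 @ b # l2))"
    using assms by (subst sum.Sigma) (auto simp: g_def split_def)
  finally show ?thesis .
qed

lemma sum_dlists_swap:
  assumes "finite S"
  shows "(\<Sum>l1\<in>dlists S. \<Sum>l2\<in>dlists (S - set l1). f l1 l2) =
    (\<Sum>l1\<in>dlists S. \<Sum>l2\<in>dlists (S - set l1). f l2 l1)"
proof -
  let ?P = "SIGMA l1:dlists S. dlists (S - set l1)"
  have "(\<Sum>(l1, l2)\<in>?P. f l1 l2) = (\<Sum>(l1, l2)\<in>?P. f l2 l1)"
    by (rule sum.reindex_bij_witness[of _ prod.swap prod.swap]) (auto simp: dlists_def)
  then show ?thesis using assms by (simp add: sum.Sigma)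
qed

text \<open>With equal endpoints, \<open>walk X a l a\<close> is the product along the cycle
  \<open>a # l\<close>, as it occurs in the Moore-Dyson determinant.\<close>

fun walk :: "(nat \<Rightarrow> nat \<Rightarrow> cquat) \<Rightarrow> nat \<Rightarrow> nat list \<Rightarrow> nat \<Rightarrow> cquat" where
  "walk X a [] b = X a b"
| "walk X a (c # l) b = X a c * walk X c l b"

lemma walk_append: "walk X a (l1 @ c # l2) b = walk X a l1 c * walk X c l2 b"
  by (induction l1 arbitrary: a) (auto simp: mult.assoc)

lemma walk_cong:
  assumes "\<And>i j. i \<in> insert a (set l) \<Longrightarrow> j \<in> insert b (set l) \<Longrightarrow> X i j = Y i j"
  shows "walk X a l b = walk Y a l b"
  using assms
proof (induction l arbitrary: a)
  case (Cons c l)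
  have "walk X c l b = walk Y c l b" by (rule Cons.IH) (auto intro: Cons.prems)
  then show ?case using Cons.prems by simp
qed auto

definition real_selfdual :: "(nat \<Rightarrow> nat \<Rightarrow> cquat) \<Rightarrow> bool" where
  "real_selfdual X \<longleftrightarrow> (\<forall>i j. real_quat (X i j) \<and> qconj (X i j) = X j i)"

lemma real_quat_walk: "real_selfdual X \<Longrightarrow> real_quat (walk X a l b)"
  by (induction l arbitrary: a) (auto simp: real_selfdual_def)

text \<open>Conjugation reverses the order of the factors and transposes each entry, which amounts
  to traversing the walk backwards.\<close>

lemma walk_rev:
  assumes "real_selfdual X"
  shows "walk X b (rev l) a = qconj (walk X a l b)"
proof (induction l arbitrary: a)
  case Nil
  then show ?case using assms by (simp add: real_selfdual_def)
next
  case (Cons c l)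
  then show ?case using assms by (simp add: walk_append qconj_mult real_selfdual_def)
qed

text \<open>Reversing a closed walk conjugates its product, so only the real parts survive the summation.\<close>

lemma sum_closed_walks:
  assumes X: "real_selfdual X" and g: "\<And>l. l \<in> dlists S \<Longrightarrow> g (rev l) = g l"
  shows "(\<Sum>l\<in>dlists S. walk X a l a * g l) = (\<Sum>l\<in>dlists S. qre (walk X a l a) *\<^sub>R g l)"
    (is "?L = ?R")
proof -
  have "?L + ?L = ?L + (\<Sum>l\<in>dlists S. walk X a (rev l) a * g (rev l))"
    using sum_dlists_rev[of "\<lambda>l. walk X a l a * g l"] by simp
  also have "\<dots> = (\<Sum>l\<in>dlists S. (walk X a l a + qconj (walk X a l a)) * g l)"
    by (simp add: walk_rev[OF X] g sum.distrib distrib_right)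
  also have "\<dots> = 2 *\<^sub>R ?R"
    by (simp add: add_qconj real_quat_walk[OF X] scaleR_sum_right)
  finally have "2 *\<^sub>R ?L = 2 *\<^sub>R ?R" by (simp add: scaleR_2)
  then show ?thesis by (metis scaleR_left_imp_eq zero_neq_numeral)
qed

text \<open>For real self-dual \<open>X\<close> this is the Moore-Dyson determinant of the submatrix with index set
  \<open>S\<close>; the recursion splits off the cycle of the largest index. On infinite \<open>S\<close> the value is 1.\<close>

function mdet :: "(nat \<Rightarrow> nat \<Rightarrow> cquat) \<Rightarrow> nat set \<Rightarrow> real" where
  "mdet X S = (if finite S \<and> S \<noteq> {} then
     \<Sum>l\<in>dlists (S - {Max S}). (- 1) ^ length l * qre (walk X (Max S) l (Max S)) *
       mdet X (S - {Max S} - set l) else 1)"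
  by auto
termination
proof (relation "Wellfounded.measure (\<lambda>(X, S). card S)", goal_cases)
  case (2 X S l)
  then show ?case by (auto intro!: psubset_card_mono Max_in)
qed auto

declare mdet.simps [simp del]

lemma mdet_empty [simp]: "mdet X {} = 1"
  by (subst mdet.simps) simp

lemma mdet_cong:
  assumes "finite S" "\<And>i j. i \<in> S \<Longrightarrow> j \<in> S \<Longrightarrow> X i j = Y i j"
  shows "mdet X S = mdet Y S"
  using assms
proof (induction "card S" arbitrary: S rule: less_induct)
  case less
  show ?case
  proof (cases "S = {}")
    case False
    have "mdet X (S - {Max S} - set l) = mdet Y (S - {Max S} - set l)" for l
      using less.prems Max_in[OF less.prems(1) False]
      by (intro less.hyps psubset_card_mono) auto
    moreover have "walk X (Max S) l (Max S) = walk Y (Max S) l (Max S)"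
      if "l \<in> dlists (S - {Max S})" for l
      using less.prems Max_in[OF less.prems(1) False] dlists_subset[OF that]
      by (intro walk_cong less.prems) auto
    ultimately show ?thesis
      by (subst (1 2) mdet.simps) simp
  qed simp
qed

text \<open>The definition singles out the largest index, but any index will do. Expanding at the
  maximum \<open>b\<close> and then at \<open>a\<close> gives a double sum over disjoint lists; it
  is symmetric in \<open>a\<close> and \<open>b\<close> because the real part of a product is
  invariant under cyclic shifts.\<close>

lemma mdet_expand:
  assumes "finite S" "a \<notin> S"
  shows "mdet X (insert a S) =
    (\<Sum>l\<in>dlists S. (- 1) ^ length l * qre (walk X a l a) * mdet X (S - set l))"
  using assms
proof (induction "card S" arbitrary: S a rule: less_induct)
  case less
  define b where "b = Max (insert a S)"
  have b: "b \<in> insert a S" unfolding b_def using less.prems by (intro Max_in) auto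
  have mb: "mdet X (insert a S) = (\<Sum>l\<in>dlists (insert a S - {b}).
    (- 1) ^ length l * qre (walk X b l b) * mdet X (insert a S - {b} - set l))"
    unfolding b_def using less.prems by (subst mdet.simps) auto
  show ?case
  proof (cases "b = a")
    case True
    then show ?thesis using mb less.prems by simp
  next
    case False
    define T where "T = S - {b}"
    have T: "S = insert b T" "a \<notin> T" "b \<notin> T" "finite T" "card T < card S"
      and eq: "insert a S - {b} = insert a T"
      using b False less.prems card_Diff1_less[of S b] by (auto simp: T_def)
    have sub: "card (T - set l) < card S" for l
      using T by (meson Diff_subset card_mono le_less_trans)
    have IH: "mdet X (insert c T - set l) = (\<Sum>l'\<in>dlists (T - set l).
        (- 1) ^ length l' * qre (walk X c l' c) * mdet X (T - set l - set l'))"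
      if "c \<notin> T" "l \<in> dlists T" for c l
    proof -
      have "insert c T - set l = insert c (T - set l)"
        using that dlists_subset by (auto simp: subset_iff)
      then show ?thesis using that T by (simp add: less.hyps[OF sub])
    qed
    \<comment> \<open>Contribution of two disjoint lists: the first summand has separate cycles
      through \<open>d\<close> and \<open>c\<close>; the second has one cycle through both, with
      \<open>c\<close> as an additional list entry, whence the \<open>Suc\<close> in the
      sign.\<close>
    define G where "G = (\<lambda>c d l1 l2. (- 1) ^ length l1 * qre (walk X d l1 d) *
      ((- 1) ^ length l2 * qre (walk X c l2 c) * mdet X (T - set l1 - set l2))
      + (- 1) ^ (Suc (length l1 + length l2)) * qre (walk X d l1 c * walk X c l2 d)
        * mdet X (T - set l1 - set l2))"
    \<comment> \<open>A list that avoids \<open>c\<close> leaves \<open>c\<close> in the remaining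
      determinant, which the induction hypothesis expands at \<open>c\<close>; a list through
      \<open>c\<close> is cut there.\<close>
    have exp: "(\<Sum>l\<in>dlists (insert c T). (- 1) ^ length l * qre (walk X d l d) *
        mdet X (insert c T - set l)) = (\<Sum>l1\<in>dlists T. \<Sum>l2\<in>dlists (T - set l1). G c d l1 l2)"
      if "c \<notin> T" for c d
    proof -
      have "insert c T - insert c (set l1 \<union> set l2) = T - set l1 - set l2" for l1 l2
        using that by auto
      then show ?thesis
        using that T
        by (simp add: sum_dlists_insert IH walk_append G_def sum.distrib sum_subtractf sum_negf sum_distrib_left)
    qed
    have swap: "G a b l1 l2 = G b a l2 l1" for l1 l2
      by (simp add: G_def qre_commute[of "walk X b l1 a"] add.commute Diff_eq ac_simps)
    have "mdet X (insert a S) = (\<Sum>l1\<in>dlists T. \<Sum>l2\<in>dlists (T - set l1). G a b l1 l2)"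
      unfolding mb eq using exp[of a b] T(2) by simp
    also have "\<dots> = (\<Sum>l1\<in>dlists T. \<Sum>l2\<in>dlists (T - set l1). G b a l1 l2)"
      by (subst sum_dlists_swap) (simp_all add: T swap)
    finally show ?thesis
      using exp[of b a] T(1,3) by simp
  qed
qed

text \<open>The determinant of the submatrix with index set \<open>S\<close> bordered by row \<open>a\<close> and column \<open>b\<close>.\<close>

definition bordered :: "(nat \<Rightarrow> nat \<Rightarrow> cquat) \<Rightarrow> nat set \<Rightarrow> nat \<Rightarrow> nat \<Rightarrow> cquat" where
  "bordered X S a b = (\<Sum>l\<in>dlists S. ((- 1) ^ length l * mdet X (S - set l)) *\<^sub>R walk X a l b)"

lemma mdet_insert:
  "finite S \<Longrightarrow> a \<notin> S \<Longrightarrow> mdet X (insert a S) = qre (bordered X S a a)"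
  by (simp add: mdet_expand bordered_def qre_sum mult_ac)

text \<open>A walk from \<open>b\<close> may or may not revisit \<open>b\<close>. If it does not,
  \<open>b\<close> stays in the complementary determinant, whose expansion contributes the real part
  of a closed walk through \<open>b\<close>. If it does, the closed walk enters as a full quaternion
  with the opposite sign. By \<open>sum_closed_walks\<close> the two contributions cancel.\<close>

lemma bordered_eq_0:
  assumes X: "real_selfdual X" and "finite S" "b \<in> S"
  shows "bordered X S b y = 0"
proof -
  define T where "T = S - {b}"
  have T: "S = insert b T" "b \<notin> T" "finite T" using assms by (auto simp: T_def)
  \<comment> \<open>\<open>g l1\<close> depends on \<open>l1\<close> only through its length and its
    set of points, so it is invariant under reversal, as \<open>sum_closed_walks\<close>
    demands.\<close>
  define g where "g = (\<lambda>l1. \<Sum>l2\<in>dlists (T - set l1).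
    ((- 1) ^ length l1 * (- 1) ^ length l2 * mdet X (T - set l1 - set l2)) *\<^sub>R walk X b l2 y)"
  have eq: "insert b T - insert b (set l1 \<union> set l2) = T - set l1 - set l2" for l1 l2
    using T by auto
  have "mdet X (insert b T - set l) = (\<Sum>l'\<in>dlists (T - set l).
      (- 1) ^ length l' * qre (walk X b l' b) * mdet X (T - set l - set l'))"
    if "l \<in> dlists T" for l
  proof -
    have "insert b T - set l = insert b (T - set l)"
      using T dlists_subset[OF that] by auto
    then show ?thesis using T by (simp add: mdet_expand)
  qed
  then have "bordered X S b y =
    (\<Sum>l\<in>dlists T. \<Sum>l'\<in>dlists (T - set l). ((- 1) ^ length l * ((- 1) ^ length l' *
       qre (walk X b l' b) * mdet X (T - set l - set l'))) *\<^sub>R walk X b l y)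
    - (\<Sum>l1\<in>dlists T. walk X b l1 b * g l1)"
    using T
    by (simp add: bordered_def sum_dlists_insert eq walk_append g_def sum_distrib_left scaleR_sum_left
        sum_negf power_add)
  \<comment> \<open>Exchanging the two lists makes the closed walk the outer one in both
    sums.\<close>
  also have "(\<Sum>l\<in>dlists T. \<Sum>l'\<in>dlists (T - set l). ((- 1) ^ length l * ((- 1) ^ length l' *
       qre (walk X b l' b) * mdet X (T - set l - set l'))) *\<^sub>R walk X b l y)
      = (\<Sum>l1\<in>dlists T. qre (walk X b l1 b) *\<^sub>R g l1)"
    using T by (subst sum_dlists_swap) (simp_all add: g_def scaleR_sum_right Diff_eq ac_simps)
  also have "\<dots> = (\<Sum>l1\<in>dlists T. walk X b l1 b * g l1)"
    by (rule sum_closed_walks[OF X, symmetric]) (simp add: g_def)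
  finally show ?thesis by simp
qed

lemma bordered_qconj:
  assumes "real_selfdual X"
  shows "bordered X S b a = qconj (bordered X S a b)"
  unfolding bordered_def
  by (subst sum_dlists_rev) (simp add: walk_rev[OF assms] qconj_sum)

lemma bordered_eq_0':
  assumes "real_selfdual X" "finite S" "b \<in> S"
  shows "bordered X S y b = 0"
  using bordered_eq_0[OF assms] bordered_qconj[OF assms(1)] by (metis qconj_simps(1))


section \<open>The Schur complement\<close>

lemma real_selfdualI:
  "(\<And>i j. real_quat (X i j)) \<Longrightarrow> (\<And>i j. qconj (X i j) = X j i) \<Longrightarrow> real_selfdual X"
  by (simp add: real_selfdual_def)

lemma real_selfdualD:
  assumes "real_selfdual X"
  shows "real_quat (X i j)" "qconj (X i j) = X j i"
  using assms by (auto simp: real_selfdual_def)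

text \<open>The matrix \<open>E X E\<^sup>*\<close>, where \<open>E\<close> adds \<open>r i\<close> times row \<open>p\<close> to row \<open>i\<close>.\<close>

definition congr :: "nat \<Rightarrow> (nat \<Rightarrow> cquat) \<Rightarrow> (nat \<Rightarrow> nat \<Rightarrow> cquat) \<Rightarrow> nat \<Rightarrow> nat \<Rightarrow> cquat" where
  "congr p r X i j = X i j + r i * X p j + X i p * qconj (r j) + r i * X p p * qconj (r j)"

lemma real_selfdual_congr:
  assumes X: "real_selfdual X" and r: "\<And>i. real_quat (r i)"
  shows "real_selfdual (congr p r X)"
  by (rule real_selfdualI)
    (simp_all add: congr_def real_selfdualD[OF X] r qconj_mult mult.assoc add_ac)

lemma congr_walk:
  assumes "a \<notin> set l" "c \<noteq> a" "\<And>i. i \<noteq> a \<Longrightarrow> r i = 0"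
  shows "walk (congr p r X) c l a = walk X c l a + walk X c l p * qconj (r a)"
  using assms
proof (induction l arbitrary: c)
  case (Cons d l)
  then have "congr p r X c d = X c d" by (auto simp: congr_def)
  with Cons show ?case by (simp add: algebra_simps)
qed (simp add: congr_def)

text \<open>Only row and column \<open>a\<close> are changed outside the source \<open>p\<close> of
  the operation, and \<open>a\<close> occurs in the walk only at its two ends: the first factor
  carries the row operation, the last one the column operation.\<close>

lemma congr_closed_walk:
  assumes "a \<notin> set l" "\<And>i. i \<noteq> a \<Longrightarrow> r i = 0"
  shows "walk (congr p r X) a l a =
    walk X a l a + r a * walk X p l a + walk X a l p * qconj (r a) + r a * walk X p l p * qconj (r a)"
proof (cases l)
  case (Cons d m)
  then have "congr p r X a d = X a d + r a * X p d"
    using assms by (auto simp: congr_def)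
  then show ?thesis using assms Cons congr_walk[of a m d r p X] by (simp add: algebra_simps)
qed (simp add: congr_def)

text \<open>The bordered determinant is additive in the border row and in the border column. Each of
  the three correction terms has a border that repeats row or column \<open>p\<close>, which lies in
  \<open>S\<close>, and therefore vanishes.\<close>

lemma mdet_congr_single:
  assumes X: "real_selfdual X" and S: "finite S" "p \<in> S" "a \<notin> S"
    and r: "\<And>i. i \<noteq> a \<Longrightarrow> r i = 0"
  shows "mdet (congr p r X) (insert a S) = mdet X (insert a S)"
proof -
  have "r i = 0" if "i \<in> S" for i using S r that by metis
  then have eq: "mdet (congr p r X) (S - set l) = mdet X (S - set l)" for l
    using S by (intro mdet_cong) (auto simp: congr_def)
  have "bordered (congr p r X) S a a =
    bordered X S a a + r a * bordered X S p a + bordered X S a p * qconj (r a)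
      + r a * bordered X S p p * qconj (r a)"
    unfolding bordered_def sum_distrib_left sum_distrib_right sum.distrib[symmetric]
  proof (rule sum.cong)
    fix l assume "l \<in> dlists S"
    then have "a \<notin> set l" using S by (auto simp: dlists_def)
    then show "((- 1) ^ length l * mdet (congr p r X) (S - set l)) *\<^sub>R walk (congr p r X) a l a =
         ((- 1) ^ length l * mdet X (S - set l)) *\<^sub>R walk X a l a +
         r a * (((- 1) ^ length l * mdet X (S - set l)) *\<^sub>R walk X p l a) +
         ((- 1) ^ length l * mdet X (S - set l)) *\<^sub>R walk X a l p * qconj (r a) +
         r a * (((- 1) ^ length l * mdet X (S - set l)) *\<^sub>R walk X p l p) * qconj (r a)"
      by (simp add: eq congr_closed_walk r scaleR_add_right)
  qed simp
  then show ?thesis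
    using S by (simp add: mdet_insert bordered_eq_0[OF X] bordered_eq_0'[OF X])
qed

text \<open>The operation is built up one target row at a time, by induction over a set that
  contains the support of \<open>r\<close>.\<close>

lemma mdet_congr:
  assumes X: "real_selfdual X" and S: "finite S" "p \<notin> S" and r: "\<And>i. real_quat (r i)"
    and "T \<subseteq> S" "\<And>i. i \<notin> T \<Longrightarrow> r i = 0"
  shows "mdet (congr p r X) (insert p S) = mdet X (insert p S)"
proof -
  have "finite T" using assms finite_subset by blast
  then show ?thesis using assms(5,6) r
  proof (induction T arbitrary: r rule: finite_induct)
    case empty
    then have "congr p r X = X" by (simp add: congr_def fun_eq_iff)
    then show ?case by simp
  next
    case (insert a T)
    define r' where "r' = r(a := 0)"
    define q where "q = (\<lambda>i. if i = a then r a else 0)"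
    have a: "a \<noteq> p" "a \<in> S" using insert S by auto
    have rp: "r p = 0" using insert.prems(1) a S by (intro insert.prems(2)) auto
    have X': "real_selfdual (congr p r' X)"
      by (rule real_selfdual_congr[OF X]) (simp add: r'_def insert.prems)
    have "r i = r' i + q i" "r' p = 0" for i
      using rp by (auto simp: r'_def q_def)
    \<comment> \<open>Since \<open>r' p = 0\<close>, composing the two operations adds their
      coefficients.\<close>
    then have eq: "congr p r X = congr p q (congr p r' X)"
      by (simp add: fun_eq_iff congr_def algebra_simps)
    have "insert a (insert p (S - {a})) = insert p S" using a by auto
    then have "mdet (congr p q (congr p r' X)) (insert p S) = mdet (congr p r' X) (insert p S)"
      using mdet_congr_single[OF X', of "insert p (S - {a})" p a q] S a by (simp add: q_def)
    also have "\<dots> = mdet X (insert p S)"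
      using insert.prems insert.hyps by (intro insert.IH) (auto simp: r'_def)
    finally show ?case by (simp add: eq)
  qed
qed

text \<open>Every cycle through \<open>p\<close> with a further point enters \<open>p\<close> from
  an index in \<open>S\<close> and so contains a zero factor; only the fixed point survives.\<close>

lemma mdet_isolated:
  assumes "finite S" "p \<notin> S" "\<And>i. i \<in> S \<Longrightarrow> X i p = 0"
  shows "mdet X (insert p S) = qre (X p p) * mdet X S"
proof -
  have z: "walk X c l p = 0" if "set l \<subseteq> S" "l \<noteq> []" for l c
    using that
  proof (induction l arbitrary: c)
    case (Cons d l)
    then show ?case using assms by (cases l) auto
  qed simp
  have "mdet X (insert p S) = (\<Sum>l\<in>dlists S. if l = [] then qre (X p p) * mdet X S else 0)"
    unfolding mdet_expand[OF assms(1,2)]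
    by (intro sum.cong) (auto simp: z dlists_subset)
  also have "\<dots> = qre (X p p) * mdet X S"
    using assms by simp
  finally show ?thesis .
qed

text \<open>Elimination with pivot \<open>X p p\<close>, performed on rows and columns at once,
  isolates \<open>p\<close> and leaves the Schur complement on \<open>S\<close>.\<close>

lemma mdet_Schur:
  assumes X: "real_selfdual X" and S: "finite S" "p \<notin> S" and s: "X p p = of_real s" "s \<noteq> 0"
  shows "mdet X (insert p S) = s * mdet (\<lambda>i j. X i j - (1 / s) *\<^sub>R (X i p * X p j)) S"
proof -
  \<comment> \<open>The coefficients cancel the entries of column \<open>p\<close> in the rows from
    \<open>S\<close>; the value 0 elsewhere gives \<open>r p = 0\<close> and the finite support that
    \<open>mdet_congr\<close> asks for.\<close>
  define r where "r = (\<lambda>i. if i \<in> S then - ((1 / s) *\<^sub>R X i p) else 0)"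
  have r: "real_quat (r i)" for i
    using real_selfdualD[OF X] by (simp add: r_def)
  have rp: "r p = 0" using S by (simp add: r_def)
  have "mdet X (insert p S) = mdet (congr p r X) (insert p S)"
    by (rule mdet_congr[OF X S r, of S, symmetric]) (auto simp: r_def)
  also have "\<dots> = qre (congr p r X p p) * mdet (congr p r X) S"
    using s by (intro mdet_isolated S) (simp add: congr_def rp, simp add: r_def of_real_def)
  also have "qre (congr p r X p p) = s"
    by (simp add: congr_def rp s)
  also have "mdet (congr p r X) S = mdet (\<lambda>i j. X i j - (1 / s) *\<^sub>R (X i p * X p j)) S"
    using s by (intro mdet_cong S)
      (simp add: congr_def r_def real_selfdualD[OF X], simp add: of_real_def)
  finally show ?thesis .
qed

text \<open>By the Schur complement formula, \<open>A + t v v\<^sup>*\<close> arises from the matrix \<open>A\<close> bordered by \<open>v\<close>, with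
  corner entry \<open>- 1 / t\<close>, and the determinant of the bordered matrix is affine in that entry.\<close>

lemma mdet_rank_one_update:
  assumes A: "real_selfdual A" and v: "\<And>i. real_quat (v i)" and S: "finite S"
  obtains d where "\<And>t. mdet (\<lambda>i j. A i j + t *\<^sub>R (v i * qconj (v j))) S = mdet A S + t * d"
proof -
  obtain p where p: "p \<notin> S" using S ex_new_if_finite by blast
  define X where "X = (\<lambda>s i j. if i = p then if j = p then of_real s else qconj (v j)
    else if j = p then v i else A i j)"
  have X: "real_selfdual (X s)" for s
    by (rule real_selfdualI) (simp_all add: X_def v real_selfdualD[OF A])
  \<comment> \<open>A closed walk at \<open>p\<close> with inner points in \<open>S\<close> uses the
    corner entry only if it is the direct step from \<open>p\<close> to \<open>p\<close>.\<close>
  have walks: "walk (X s) c l p = walk (X 0) c l p" if "set l \<subseteq> S" "l \<noteq> [] \<or> c \<noteq> p" for s c l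
    using that
  proof (induction l arbitrary: c)
    case (Cons d l)
    with p have "d \<noteq> p" by auto
    with Cons show ?case by (simp add: X_def)
  qed (simp add: X_def)
  have sub: "mdet (X s) (S - T) = mdet A (S - T)" for s T
    using S p by (intro mdet_cong) (auto simp: X_def)
  define C where "C = (\<Sum>l\<in>dlists S - {[]}. (- 1) ^ length l * qre (walk (X 0) p l p) * mdet A (S - set l))"
  have exp: "mdet (X s) (insert p S) = s * mdet A S + C" for s
  proof -
    have "mdet (X s) (insert p S) =
      (\<Sum>l\<in>dlists S. (- 1) ^ length l * qre (walk (X s) p l p) * mdet A (S - set l))"
      unfolding mdet_expand[OF S p] sub ..
    also have "\<dots> = s * mdet A S +
      (\<Sum>l\<in>dlists S - {[]}. (- 1) ^ length l * qre (walk (X s) p l p) * mdet A (S - set l))"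
      using S by (subst sum.remove[of _ "[]"]) (simp_all add: X_def)
    also have "(\<Sum>l\<in>dlists S - {[]}. (- 1) ^ length l * qre (walk (X s) p l p) * mdet A (S - set l)) = C"
      unfolding C_def
    proof (rule sum.cong)
      fix l assume l: "l \<in> dlists S - {[]}"
      then have "walk (X s) p l p = walk (X 0) p l p"
        by (intro walks dlists_subset) auto
      then show "(- 1) ^ length l * qre (walk (X s) p l p) * mdet A (S - set l) =
          (- 1) ^ length l * qre (walk (X 0) p l p) * mdet A (S - set l)" by simp
    qed simp
    finally show ?thesis .
  qed
  show ?thesis
  proof
    fix t :: real
    show "mdet (\<lambda>i j. A i j + t *\<^sub>R (v i * qconj (v j))) S = mdet A S + t * (- C)"
    proof (cases "t = 0")
      case False
      \<comment> \<open>Comparing the Schur complement with \<open>exp\<close> at the corner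
        \<open>- 1 / t\<close> and multiplying by \<open>- t\<close> gives the slope
        \<open>- C\<close>.\<close>
      have "mdet (X (- 1 / t)) (insert p S) = (- 1 / t) * mdet (\<lambda>i j. X (- 1 / t) i j
          - (1 / (- 1 / t)) *\<^sub>R (X (- 1 / t) i p * X (- 1 / t) p j)) S"
        using False by (intro mdet_Schur X S p) (auto simp: X_def)
      also have "mdet (\<lambda>i j. X (- 1 / t) i j
          - (1 / (- 1 / t)) *\<^sub>R (X (- 1 / t) i p * X (- 1 / t) p j)) S
        = mdet (\<lambda>i j. A i j + t *\<^sub>R (v i * qconj (v j))) S"
        using p by (intro mdet_cong S) (auto simp: X_def)
      finally show ?thesis using False exp[of "- 1 / t"] by (simp add: field_simps)
    qed simp
  qed
qed

text \<open>Positivity and Hadamard's inequality, by induction over the index set: the Schur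
  complement of a Gram matrix is again a Gram matrix, and its diagonal entries are not larger than
  the original ones.\<close>

lemma mdet_Gram_bounds:
  assumes "finite S" and v: "\<And>k i. real_quat (v k i)"
    and X: "\<And>i j. X i j = (\<Sum>k\<in>J. v k i * qconj (v k j))"
  shows "0 \<le> mdet X S \<and> mdet X S \<le> (\<Prod>i\<in>S. qre (X i i))"
  using assms
proof (induction S arbitrary: v X rule: finite_induct)
  case (insert p S)
  note v = insert.prems(1) and Xeq = insert.prems(2)
  have X: "real_selfdual X"
    by (rule real_selfdualI) (simp_all add: Xeq v real_quat_sum qconj_sum qconj_mult)
  define s where "s = (\<Sum>k\<in>J. (norm (v k p))\<^sup>2)"
  have s: "X p p = of_real s" by (simp add: Xeq s_def mult_qconj[OF v])
  have nn: "0 \<le> qre (X i i)" for i by (simp add: Xeq qre_sum qre_mult_qconj[OF v] sum_nonneg)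
  show ?case
  proof (cases "s = 0")
    case True
    \<comment> \<open>For finite \<open>J\<close> a vanishing sum of squares forces
      \<open>v k p = 0\<close>; for infinite \<open>J\<close> all sums have the default value
      0.\<close>
    have "X i p = 0" for i
    proof (cases "finite J")
      case True
      with \<open>s = 0\<close> have "v k p = 0" if "k \<in> J" for k
        using that by (auto simp: s_def sum_nonneg_eq_0_iff)
      then show ?thesis by (simp add: Xeq)
    qed (simp add: Xeq)
    then have "mdet X (insert p S) = 0"
      using mdet_isolated[of S p X] insert.hyps s True by simp
    moreover have "0 \<le> (\<Prod>i\<in>insert p S. qre (X i i))"
      by (intro prod_nonneg nn)
    ultimately show ?thesis by simp
  next
    case False
    have s0: "s > 0" using False by (simp add: s_def sum_nonneg less_le)
    \<comment> \<open>A Gram-Schmidt step: \<open>w\<close> removes from row \<open>i\<close> its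
      component along row \<open>p\<close>, and the Schur complement \<open>Y\<close> is the Gram
      matrix of \<open>w\<close>.\<close>
    define w where "w = (\<lambda>k i. v k i - (1 / s) *\<^sub>R (X i p * v k p))"
    define Y where "Y = (\<lambda>i j. X i j - (1 / s) *\<^sub>R (X i p * X p j))"
    have w: "real_quat (w k i)" for k i
      by (simp add: w_def v real_selfdualD[OF X])
    have Y: "Y i j = (\<Sum>k\<in>J. w k i * qconj (w k j))" for i j
    proof -
      have "w k i * qconj (w k j) = v k i * qconj (v k j) - (1 / s) *\<^sub>R (X i p * (v k p * qconj (v k j)))
         - (1 / s) *\<^sub>R ((v k i * qconj (v k p)) * X p j)
         + (1 / s) *\<^sub>R ((1 / s) *\<^sub>R (X i p * (v k p * qconj (v k p)) * X p j))" for k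
        by (simp add: w_def qconj_mult real_selfdualD[OF X] algebra_simps)
      then have "(\<Sum>k\<in>J. w k i * qconj (w k j)) = X i j - (1 / s) *\<^sub>R (X i p * X p j)
         - (1 / s) *\<^sub>R (X i p * X p j) + (1 / s) *\<^sub>R ((1 / s) *\<^sub>R (X i p * X p p * X p j))"
        by (simp add: sum.distrib sum_subtractf scaleR_sum_right[symmetric] sum_distrib_left[symmetric]
            sum_distrib_right[symmetric] Xeq[symmetric])
      then show ?thesis using s0 by (simp add: Y_def s of_real_def)
    qed
    have IH: "0 \<le> mdet Y S" "mdet Y S \<le> (\<Prod>i\<in>S. qre (Y i i))"
      using insert.IH[of w Y, OF w Y] by blast+
    have eq: "mdet X (insert p S) = s * mdet Y S"
      unfolding Y_def using s s0 insert.hyps by (intro mdet_Schur X) auto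
    have "qre (Y i i) \<le> qre (X i i)" for i
    proof -
      have "qre (X i p * X p i) = (norm (X i p))\<^sup>2"
        using qre_mult_qconj[of "X i p"] by (simp add: real_selfdualD[OF X])
      then show ?thesis using s0 by (simp add: Y_def)
    qed
    moreover have "0 \<le> qre (Y i i)" for i
      by (simp add: Y qre_sum qre_mult_qconj[OF w] sum_nonneg)
    ultimately have "(\<Prod>i\<in>S. qre (Y i i)) \<le> (\<Prod>i\<in>S. qre (X i i))"
      by (intro prod_mono) auto
    with IH have "mdet Y S \<le> (\<Prod>i\<in>S. qre (X i i))" by linarith
    then have "s * mdet Y S \<le> s * (\<Prod>i\<in>S. qre (X i i))"
      using s0 by simp
    then show ?thesis using eq IH s0 insert.hyps by (simp add: s)
  qed
qed simp


section \<open>Permutations and the Moore-Dyson determinant\<close>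

lemma support_Cons:
  assumes "permutation p"
  shows "support p a = a # tl (support p a)"
  using least_power_of_permutation(2)[OF assms, of a] by (simp add: upt_conv_Cons)

text \<open>One half of the bijection in \<open>sum_permutes_cycle\<close>. Distinct cycles are
  disjoint, so a point outside the cycle of \<open>a\<close> is mapped outside it.\<close>

lemma cycle_of_support_comp_perm_restrict:
  assumes "p permutes S" "finite S"
  shows "cycle_of_list (support p a) \<circ> perm_restrict p (S - set (support p a)) = p"
proof
  have perm: "permutation p" using assms permutation_permutes by blast
  fix x
  consider "x \<in> S - set (support p a)" | "x \<in> set (support p a)" | "x \<notin> S" "x \<notin> set (support p a)"
    by blast
  then show "(cycle_of_list (support p a) \<circ> perm_restrict p (S - set (support p a))) x = p x"
  proof cases
    case 1
    have "p x \<notin> set (support p a)"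
    proof
      assume "p x \<in> set (support p a)"
      moreover have "p x = (p ^^ 1) x" by simp
      then have "p x \<in> set (support p x)"
        unfolding support_set[OF perm] by blast
      ultimately show False using 1 disjoint_support'[OF perm, of x a] by blast
    qed
    with 1 show ?thesis by (simp add: perm_restrict_def id_outside_supp)
  next
    case 2
    then show ?thesis using cycle_restrict[OF perm] by (simp add: perm_restrict_def)
  next
    case 3
    then show ?thesis using permutes_not_in[OF assms(1)] by (simp add: perm_restrict_def id_outside_supp)
  qed
qed

section \<open>Adjoining a cycle to a permutation of the remaining points\<close>

context
  fixes cs :: "'a list" and a l \<tau> S \<sigma>
  assumes cs: "cs = a # l" "distinct cs" "set cs \<subseteq> S" and \<tau>: "\<tau> permutes S - set cs"
    and \<sigma>: "\<sigma> = cycle_of_list cs \<circ> \<tau>"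
begin

lemma cycle_comp_permutes: "\<sigma> permutes S"
proof -
  have "cycle_of_list cs permutes S" "\<tau> permutes S"
    using permutes_subset[OF cycle_permutes cs(3)] permutes_subset[OF \<tau>] by auto
  then show ?thesis unfolding \<sigma> by (rule permutes_compose[rotated])
qed

lemma cycle_comp_in: "x \<in> set cs \<Longrightarrow> \<sigma> x = cycle_of_list cs x"
  using \<tau> by (simp add: \<sigma> permutes_not_in)

lemma cycle_comp_notin: "x \<notin> set cs \<Longrightarrow> \<sigma> x = \<tau> x"
proof -
  assume "x \<notin> set cs"
  then have "\<tau> x \<notin> set cs"
    using \<tau> by (metis DiffD2 permutes_in_image permutes_not_in)
  then show ?thesis by (simp add: \<sigma> id_outside_supp)
qed

lemma cycle_comp_funpow_notin: "x \<notin> set cs \<Longrightarrow> (\<sigma> ^^ n) x = (\<tau> ^^ n) x \<and> (\<tau> ^^ n) x \<notin> set cs"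
proof (induction n)
  case (Suc n)
  have "\<tau> y \<notin> set cs" if "y \<notin> set cs" for y
    using \<tau> that by (metis DiffD2 permutes_in_image permutes_not_in)
  with Suc show ?case by (simp add: cycle_comp_notin)
qed simp

text \<open>Applying the cycle rotates its list by one position; iterated from \<open>a\<close>,
  this visits \<open>cs\<close> entry by entry, so that \<open>support\<close> recovers
  \<open>cs\<close>.\<close>

lemma map_cycle_comp: "map \<sigma> cs = l @ [a]"
proof -
  have "map \<sigma> cs = map (cycle_of_list cs) cs" by (simp add: cycle_comp_in)
  also have "\<dots> = l @ [a]" using cyclic_rotation[OF cs(2), of 1] cs(1) by simp
  finally show ?thesis .
qed

lemma cycle_comp_funpow: "n < length cs \<Longrightarrow> (\<sigma> ^^ n) a = cs ! n"
proof (induction n)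
  case (Suc n)
  then have "(\<sigma> ^^ Suc n) a = map \<sigma> cs ! n" by simp
  also have "\<dots> = cs ! Suc n" using Suc.prems unfolding map_cycle_comp by (simp add: cs nth_append)
  finally show ?case .
qed (simp add: cs)

lemma cycle_comp_least_power: "least_power \<sigma> a = length cs"
  unfolding least_power_def
proof (rule Least_equality)
  have "(\<sigma> ^^ length cs) a = \<sigma> ((\<sigma> ^^ length l) a)" by (simp add: cs)
  also have "\<dots> = map \<sigma> cs ! length l" by (subst nth_map) (simp_all add: cycle_comp_funpow cs(1))
  also have "\<dots> = a" unfolding map_cycle_comp by simp
  finally show "(\<sigma> ^^ length cs) a = a \<and> 0 < length cs" by (simp add: cs)
next
  fix n assume n: "(\<sigma> ^^ n) a = a \<and> 0 < n"
  show "length cs \<le> n"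
  proof (rule ccontr)
    assume "\<not> ?thesis"
    then have "cs ! n = (\<sigma> ^^ n) a" by (simp add: cycle_comp_funpow)
    then have "cs ! n = cs ! 0" using n cs(1) by simp
    with \<open>\<not> ?thesis\<close> n show False using nth_eq_iff_index_eq[OF cs(2), of n 0] by linarith
  qed
qed

lemma support_cycle_comp: "support \<sigma> a = cs"
  by (rule nth_equalityI) (simp_all add: cycle_comp_least_power cycle_comp_funpow)

lemma perm_restrict_cycle_comp: "perm_restrict \<sigma> (S - set cs) = \<tau>"
  using \<tau> by (auto simp: fun_eq_iff perm_restrict_def cycle_comp_notin permutes_not_in)

lemma support_cycle_comp_notin: "x \<notin> set cs \<Longrightarrow> support \<sigma> x = support \<tau> x"
  by (simp add: least_power_def cycle_comp_funpow_notin)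

lemma orbit_cycle_comp_notin: "x \<notin> set cs \<Longrightarrow> orbit \<sigma> x = orbit \<tau> x"
  by (simp add: orbit_altdef cycle_comp_funpow_notin)

end

text \<open>The index set is arbitrary here, since splitting off a cycle leaves a set with
  gaps.\<close>

definition leaders :: "nat set \<Rightarrow> (nat \<Rightarrow> nat) \<Rightarrow> nat set" where
  "leaders S \<sigma> = {a \<in> S. \<forall>b\<in>orbit \<sigma> a. b \<le> a}"

definition Moore_term :: "(nat \<Rightarrow> nat \<Rightarrow> cquat) \<Rightarrow> nat set \<Rightarrow> (nat \<Rightarrow> nat) \<Rightarrow> cquat" where
  "Moore_term X S \<sigma> = (- 1) ^ (card S - card (leaders S \<sigma>)) *
    prod_list (map (cycle_product X \<sigma>) (rev (sorted_list_of_set (leaders S \<sigma>))))"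

lemma map2_map: "map2 f xs (map g xs) = map (\<lambda>x. f x (g x)) xs"
  by (induction xs) auto

lemma prod_list_walk: "prod_list (map2 X (c # l) (l @ [b])) = walk X c l b"
  by (induction l arbitrary: c) auto

lemma sorted_list_of_set_insert_greatest:
  assumes "finite A" "\<And>x. x \<in> A \<Longrightarrow> x < (a::nat)"
  shows "sorted_list_of_set (insert a A) = sorted_list_of_set A @ [a]"
proof -
  have "a \<notin> A" using assms(2) by blast
  then show ?thesis
    using assms by (simp add: sorted_insort_is_snoc less_imp_le)
qed

text \<open>As the greatest index, \<open>a\<close> leads its cycle, and that cycle comes first in
  Moore's ordering, so its product factors out on the left. A cycle of \<open>length l + 1\<close>
  points contributes \<open>length l\<close> to the exponent of the sign.\<close>

lemma Moore_term_cycle_comp: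
  assumes S: "finite S" "a \<in> S" and a: "\<And>x. x \<in> S \<Longrightarrow> x \<le> a"
    and l: "l \<in> dlists (S - {a})" and \<tau>: "\<tau> permutes S - {a} - set l"
    and \<sigma>: "\<sigma> = cycle_of_list (a # l) \<circ> \<tau>"
  shows "Moore_term X S \<sigma> = (- 1) ^ length l * walk X a l a * Moore_term X (S - {a} - set l) \<tau>"
proof -
  define T where "T = S - {a} - set l"
  have cs: "a # l = a # l" "distinct (a # l)" "set (a # l) \<subseteq> S"
    using l S by (auto simp: dlists_def)
  have T: "T = S - set (a # l)" "finite T" using S by (auto simp: T_def)
  have \<tau>': "\<tau> permutes S - set (a # l)" using \<tau> T by (simp add: T_def)
  note cc = cs \<tau>' \<sigma>
  have \<sigma>S: "\<sigma> permutes S" by (rule cycle_comp_permutes[OF cc])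
  then have perm: "permutation \<sigma>" using S permutation_permutes by blast
  have orb_a: "orbit \<sigma> a = set (a # l)"
    using support_set[OF perm, of a] unfolding support_cycle_comp[OF cc]
    by (auto simp: orbit_altdef_permutation[OF perm])
  have "leaders S \<sigma> = insert a (leaders T \<tau>)"
  proof (intro equalityI subsetI)
    fix b assume b: "b \<in> leaders S \<sigma>"
    show "b \<in> insert a (leaders T \<tau>)"
    proof (cases "b \<in> set (a # l)")
      case True
      \<comment> \<open>Since \<open>a\<close> lies in the orbit of every point of its cycle and is
        maximal, no other point of the cycle is a leader.\<close>
      then have "a \<in> orbit \<sigma> b"
        using orbit_swap[OF permutation_self_in_orbit[OF perm]] orb_a by blast
      then show ?thesis using b a by (force simp: leaders_def)
    qed (use b T orbit_cycle_comp_notin[OF cc] in \<open>auto simp: leaders_def\<close>)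
  next
    fix b assume "b \<in> insert a (leaders T \<tau>)"
    then show "b \<in> leaders S \<sigma>"
    proof
      assume "b = a"
      then show ?thesis using orb_a a S cs by (auto simp: leaders_def)
    qed (use T orbit_cycle_comp_notin[OF cc] in \<open>auto simp: leaders_def\<close>)
  qed
  moreover have lT: "leaders T \<tau> \<subseteq> T" by (auto simp: leaders_def)
  moreover have "finite (leaders T \<tau>)" using lT T(2) by (rule finite_subset)
  ultimately have leaders: "leaders S \<sigma> = insert a (leaders T \<tau>)" "finite (leaders T \<tau>)" "a \<notin> leaders T \<tau>"
    by (auto simp: T_def)
  have "x < a" if "x \<in> leaders T \<tau>" for x
    using that lT a[of x] by (force simp: T_def)
  then have sorted: "sorted_list_of_set (leaders S \<sigma>) = sorted_list_of_set (leaders T \<tau>) @ [a]"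
    unfolding leaders by (intro sorted_list_of_set_insert_greatest leaders)
  have "cycle_product X \<sigma> b = cycle_product X \<tau> b" if "b \<in> leaders T \<tau>" for b
  proof -
    have b: "b \<notin> set (a # l)" using that lT T by auto
    have "\<sigma> x = \<tau> x" if "x \<in> set (support \<tau> b)" for x
      using that cycle_comp_funpow_notin[OF cc b] cycle_comp_notin[OF cc] by auto
    then have "map (\<lambda>i. X i (\<sigma> i)) (support \<tau> b) = map (\<lambda>i. X i (\<tau> i)) (support \<tau> b)"
      by (intro map_cong refl) metis
    then show ?thesis
      unfolding cycle_product_def support_cycle_comp_notin[OF cc b] by (rule arg_cong)
  qed
  then have prods: "map (cycle_product X \<sigma>) (rev (sorted_list_of_set (leaders T \<tau>))) =
      map (cycle_product X \<tau>) (rev (sorted_list_of_set (leaders T \<tau>)))"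
    using leaders by simp
  have "cycle_product X \<sigma> a = prod_list (map2 X (a # l) (map \<sigma> (a # l)))"
    unfolding cycle_product_def support_cycle_comp[OF cc]
    by (simp only: map2_map)
  also have "\<dots> = walk X a l a"
    unfolding map_cycle_comp[OF cc] by (rule prod_list_walk)
  finally have cp: "cycle_product X \<sigma> a = walk X a l a" .
  have "card (set (a # l)) = Suc (length l)" using cs by (simp add: distinct_card)
  then have "card S = Suc (length l + card T)"
    using T S cs by (metis add_Suc card_Diff_subset card_mono finite_set le_add_diff_inverse)
  \<comment> \<open>This bound makes the truncated subtraction in the exponent exact.\<close>
  moreover have "card (leaders T \<tau>) \<le> card T" using T lT by (simp add: card_mono)
  ultimately have "card S - card (leaders S \<sigma>) = length l + (card T - card (leaders T \<tau>))"
    using leaders by simp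
  moreover have "walk X a l a * ((- 1) ^ n * y) = (- 1) ^ n * (walk X a l a * y)" for n y
    by (cases "even n") auto
  ultimately show ?thesis
    unfolding Moore_term_def T_def[symmetric]
    by (simp add: sorted prods cp power_add mult.assoc)
qed

text \<open>A permutation corresponds bijectively to the cycle of \<open>a\<close>, written as a
  list starting at \<open>a\<close>, together with a permutation of the points off that
  cycle.\<close>

lemma sum_permutes_cycle:
  fixes f :: "(nat \<Rightarrow> nat) \<Rightarrow> 'b::comm_monoid_add"
  assumes "finite S" "a \<in> S"
  shows "(\<Sum>\<sigma> | \<sigma> permutes S. f \<sigma>) =
    (\<Sum>l\<in>dlists (S - {a}). \<Sum>\<tau> | \<tau> permutes S - {a} - set l. f (cycle_of_list (a # l) \<circ> \<tau>))"
proof -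
  let ?P = "SIGMA l:dlists (S - {a}). {\<tau>. \<tau> permutes S - {a} - set l}"
  have cc: "distinct (a # l)" "set (a # l) \<subseteq> S" "\<tau> permutes S - set (a # l)"
    "S - set (a # l) = S - {a} - set l"
    if "(l, \<tau>) \<in> ?P" for l \<tau>
  proof -
    show eq: "S - set (a # l) = S - {a} - set l" by auto
    show "distinct (a # l)" "set (a # l) \<subseteq> S" "\<tau> permutes S - set (a # l)"
      unfolding eq using that assms by (auto simp: dlists_def)
  qed
  have "(\<Sum>\<sigma> | \<sigma> permutes S. f \<sigma>) = (\<Sum>(l, \<tau>)\<in>?P. f (cycle_of_list (a # l) \<circ> \<tau>))"
  proof (rule sum.reindex_bij_witness[of _ "\<lambda>(l, \<tau>). cycle_of_list (a # l) \<circ> \<tau>"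
        "\<lambda>\<sigma>. (tl (support \<sigma> a), perm_restrict \<sigma> (S - set (support \<sigma> a)))"])
    fix \<sigma> assume "\<sigma> \<in> {\<sigma>. \<sigma> permutes S}"
    then have \<sigma>: "\<sigma> permutes S" by simp
    then have perm: "permutation \<sigma>" using assms permutation_permutes by blast
    define l where "l = tl (support \<sigma> a)"
    have supp: "support \<sigma> a = a # l" unfolding l_def by (rule support_Cons[OF perm])
    have "cycle_of_list (a # l) \<circ> perm_restrict \<sigma> (S - set (a # l)) = \<sigma>"
      using cycle_of_support_comp_perm_restrict[OF \<sigma> assms(1), of a] unfolding supp .
    then show 1: "(case (tl (support \<sigma> a), perm_restrict \<sigma> (S - set (support \<sigma> a))) of
        (l, \<tau>) \<Rightarrow> cycle_of_list (a # l) \<circ> \<tau>) = \<sigma>"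
      unfolding supp by simp
    have "set (support \<sigma> a) \<subseteq> S"
      using permutes_in_image[OF permutes_funpow[OF \<sigma>]] assms by auto
    moreover have "distinct (support \<sigma> a)" by (rule cycle_of_permutation[OF perm])
    ultimately have "l \<in> dlists (S - {a})"
      unfolding supp by (auto simp: dlists_def)
    moreover have "perm_restrict \<sigma> (S - set (a # l)) permutes (S - set (a # l))"
      using semidecomposition[OF \<sigma> assms(1), of a] unfolding perm_restrict_def supp .
    moreover have "S - set (a # l) = S - {a} - set l" by auto
    ultimately show "(tl (support \<sigma> a), perm_restrict \<sigma> (S - set (support \<sigma> a))) \<in> ?P"
      unfolding supp by simp
    show "(case (tl (support \<sigma> a), perm_restrict \<sigma> (S - set (support \<sigma> a))) of
        (l, \<tau>) \<Rightarrow> f (cycle_of_list (a # l) \<circ> \<tau>)) = f \<sigma>"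
      using arg_cong[OF 1, of f] by simp
  next
    fix q assume "q \<in> ?P"
    then obtain l \<tau> where q: "q = (l, \<tau>)" "(l, \<tau>) \<in> ?P" by (cases q) auto
    note c = refl cc(1-3)[OF q(2)] refl
    have "support (cycle_of_list (a # l) \<circ> \<tau>) a = a # l"
      by (rule support_cycle_comp[OF c])
    moreover have "perm_restrict (cycle_of_list (a # l) \<circ> \<tau>) (S - set (a # l)) = \<tau>"
      by (rule perm_restrict_cycle_comp[OF c])
    ultimately show "(tl (support (case q of (l, \<tau>) \<Rightarrow> cycle_of_list (a # l) \<circ> \<tau>) a),
        perm_restrict (case q of (l, \<tau>) \<Rightarrow> cycle_of_list (a # l) \<circ> \<tau>)
         (S - set (support (case q of (l, \<tau>) \<Rightarrow> cycle_of_list (a # l) \<circ> \<tau>) a))) = q"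
      by (simp only: q prod.case) simp
    show "(case q of (l, \<tau>) \<Rightarrow> cycle_of_list (a # l) \<circ> \<tau>) \<in> {\<sigma>. \<sigma> permutes S}"
      using cycle_comp_permutes[OF c] by (simp only: q prod.case) simp
  qed
  also have "\<dots> = (\<Sum>l\<in>dlists (S - {a}). \<Sum>\<tau> | \<tau> permutes S - {a} - set l. f (cycle_of_list (a # l) \<circ> \<tau>))"
    using assms by (subst sum.Sigma) (auto intro: finite_permutations)
  finally show ?thesis .
qed

text \<open>The cycle of the largest index comes first. By induction, the sum over all choices of
  the other cycles is scalar, so the sum over closed walks through that index reduces to real parts,
  which is the recursion of \<open>mdet\<close>.\<close>

lemma sum_Moore_term:
  assumes X: "real_selfdual X" and "finite S"
  shows "(\<Sum>\<sigma> | \<sigma> permutes S. Moore_term X S \<sigma>) = of_real (mdet X S)"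
  using assms(2)
proof (induction "card S" arbitrary: S rule: less_induct)
  case less
  show ?case
  proof (cases "S = {}")
    case True
    then show ?thesis by (simp add: Moore_term_def leaders_def)
  next
    case False
    define a where "a = Max S"
    define T where "T = S - {a}"
    have aS: "a \<in> S" unfolding a_def by (rule Max_in[OF less.prems False])
    then have a: "a \<in> S" "\<And>x. x \<in> S \<Longrightarrow> x \<le> a" "S = insert a T" "a \<notin> T" "finite T" "card T < card S"
      using less.prems card_Diff1_less[OF less.prems aS] by (auto simp: a_def T_def)
    have IH: "(\<Sum>\<tau> | \<tau> permutes T - set l. Moore_term X (T - set l) \<tau>) = of_real (mdet X (T - set l))" for l
      using a by (intro less.hyps) (auto intro: le_less_trans[OF card_mono[of T]])
    have "(\<Sum>\<sigma> | \<sigma> permutes S. Moore_term X S \<sigma>) =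
      (\<Sum>l\<in>dlists T. \<Sum>\<tau> | \<tau> permutes T - set l. Moore_term X S (cycle_of_list (a # l) \<circ> \<tau>))"
      unfolding T_def by (rule sum_permutes_cycle[OF less.prems a(1)])
    also have "\<dots> = (\<Sum>l\<in>dlists T. \<Sum>\<tau> | \<tau> permutes T - set l.
        (- 1) ^ length l * walk X a l a * Moore_term X (T - set l) \<tau>)"
      using Moore_term_cycle_comp[OF less.prems a(1,2)]
      by (intro sum.cong) (auto simp: T_def)
    also have "\<dots> = (\<Sum>l\<in>dlists T. walk X a l a * (((- 1) ^ length l * mdet X (T - set l)) *\<^sub>R 1))"
    proof (unfold sum_distrib_left[symmetric] IH, rule sum.cong)
      fix l
      show "(- 1) ^ length l * walk X a l a * of_real (mdet X (T - set l)) =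
          walk X a l a * (((- 1) ^ length l * mdet X (T - set l)) *\<^sub>R 1)"
        by (cases "even (length l)") (simp_all add: of_real_def)
    qed simp
    also have "\<dots> = (\<Sum>l\<in>dlists T. qre (walk X a l a) *\<^sub>R (((- 1) ^ length l * mdet X (T - set l)) *\<^sub>R 1))"
      by (rule sum_closed_walks[OF X]) simp
    also have "\<dots> = of_real (mdet X S)"
      unfolding a(3) using a by (simp add: mdet_expand of_real_def scaleR_sum_left mult_ac)
    finally show ?thesis .
  qed
qed

lemma Det_M_eq_mdet:
  assumes "real_selfdual X"
  shows "Det_M n X = of_real (mdet X {..<n})"
  using sum_Moore_term[OF assms, of "{..<n}"]
  by (simp add: Det_M_def Moore_term_def leaders_def cycle_leaders_def)


section \<open>Determinants of kernels in diagonal form\<close>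

text \<open>\<open>v k i\<close> stands for the value of the k-th eigenfunction at the i-th
  point.\<close>

definition gram_kernel :: "nat set \<Rightarrow> (nat \<Rightarrow> real) \<Rightarrow> (nat \<Rightarrow> nat \<Rightarrow> cquat) \<Rightarrow> nat \<Rightarrow> nat \<Rightarrow> cquat" where
  "gram_kernel J c v i j = (\<Sum>k\<in>J. c k *\<^sub>R (v k i * qconj (v k j)))"

lemma real_selfdual_gram_kernel:
  assumes "\<And>k i. k \<in> J \<Longrightarrow> real_quat (v k i)"
  shows "real_selfdual (gram_kernel J c v)"
  using assms
  by (intro real_selfdualI) (auto simp: gram_kernel_def real_quat_sum qconj_sum qconj_mult)

lemma gram_kernel_insert:
  assumes "finite J" "k \<notin> J"
  shows "gram_kernel (insert k J) (c(k := t)) v =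
    (\<lambda>i j. gram_kernel J c v i j + t *\<^sub>R (v k i * qconj (v k j)))"
proof -
  have "(\<Sum>l\<in>J. (c(k := t)) l *\<^sub>R (v l i * qconj (v l j))) = (\<Sum>l\<in>J. c l *\<^sub>R (v l i * qconj (v l j)))" for i j
    using assms by (intro sum.cong) auto
  then show ?thesis using assms by (simp add: gram_kernel_def fun_eq_iff add.commute)
qed

lemma mdet_gram_kernel_bounds:
  assumes "finite S" and v: "\<And>k i. k \<in> J \<Longrightarrow> real_quat (v k i)" and c: "\<And>k. k \<in> J \<Longrightarrow> 0 \<le> c k"
  shows "0 \<le> mdet (gram_kernel J c v) S"
    and "mdet (gram_kernel J c v) S \<le> (\<Prod>i\<in>S. \<Sum>k\<in>J. c k * (norm (v k i))\<^sup>2)"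
proof -
  \<comment> \<open>Nonnegative coefficients are absorbed as square roots; the zero vectors outside
    \<open>J\<close> are there because \<open>mdet_Gram_bounds\<close> speaks of all
    \<open>k\<close>.\<close>
  define w where "w = (\<lambda>k i. if k \<in> J then sqrt (c k) *\<^sub>R v k i else 0)"
  have w: "real_quat (w k i)" for k i using v by (simp add: w_def)
  have "gram_kernel J c v i j = (\<Sum>k\<in>J. w k i * qconj (w k j))" for i j
    unfolding gram_kernel_def by (intro sum.cong) (auto simp: w_def c)
  note bounds = mdet_Gram_bounds[OF assms(1) w this]
  then show "0 \<le> mdet (gram_kernel J c v) S" ..
  have "qre (gram_kernel J c v i i) = (\<Sum>k\<in>J. c k * (norm (v k i))\<^sup>2)" for i
    unfolding gram_kernel_def qre_sum by (intro sum.cong) (auto simp: qre_mult_qconj v)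
  with bounds show "mdet (gram_kernel J c v) S \<le> (\<Prod>i\<in>S. \<Sum>k\<in>J. c k * (norm (v k i))\<^sup>2)" by simp
qed

lemma mdet_gram_kernel_affine:
  assumes "finite S" and v: "\<And>k i. k \<in> J \<Longrightarrow> real_quat (v k i)" and "finite J" "k \<in> J"
  obtains d where "\<And>t. mdet (gram_kernel J (c(k := t)) v) S = mdet (gram_kernel (J - {k}) c v) S + t * d"
proof -
  have J: "insert k (J - {k}) = J" using assms by auto
  have "gram_kernel J (c(k := t)) v =
      (\<lambda>i j. gram_kernel (J - {k}) c v i j + t *\<^sub>R (v k i * qconj (v k j)))" for t
    using gram_kernel_insert[of "J - {k}" k c t v] assms unfolding J by simp
  moreover have "real_selfdual (gram_kernel (J - {k}) c v)"
    using v by (intro real_selfdual_gram_kernel) auto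
  ultimately show ?thesis
    using mdet_rank_one_update[of "gram_kernel (J - {k}) c v" "v k" S] v assms that by metis
qed

text \<open>An affine function that is nonnegative on \<open>[0, \<infinity>)\<close> is nondecreasing, so positivity gives
  monotonicity.\<close>

lemma mdet_gram_kernel_insert_mono:
  assumes S: "finite S" and v: "\<And>l i. l \<in> insert k J \<Longrightarrow> real_quat (v l i)"
    and c: "\<And>l. l \<in> insert k J \<Longrightarrow> 0 \<le> c l" and J: "finite J"
  shows "mdet (gram_kernel J c v) S \<le> mdet (gram_kernel (insert k J) c v) S"
proof (cases "k \<in> J")
  case False
  obtain d where d: "\<And>t. mdet (gram_kernel (insert k J) (c(k := t)) v) S =
      mdet (gram_kernel (insert k J - {k}) c v) S + t * d"
    using mdet_gram_kernel_affine[of S "insert k J" v k c] S v J by (metis finite_insert insertI1)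
  then have d: "\<And>t. mdet (gram_kernel (insert k J) (c(k := t)) v) S = mdet (gram_kernel J c v) S + t * d"
    using False by simp
  have "d \<ge> 0"
  proof (rule ccontr)
    assume "\<not> d \<ge> 0"
    \<comment> \<open>At this \<open>t\<close> the affine function takes the value
      \<open>- 1\<close>.\<close>
    define t where "t = (mdet (gram_kernel J c v) S + 1) / (- d)"
    have "mdet (gram_kernel J c v) S \<ge> 0"
      by (rule mdet_gram_kernel_bounds(1)[OF S]) (auto simp: v c)
    then have t: "t \<ge> 0" using \<open>\<not> d \<ge> 0\<close> unfolding t_def by (intro divide_nonneg_pos) auto
    then have "0 \<le> mdet (gram_kernel (insert k J) (c(k := t)) v) S"
      by (intro mdet_gram_kernel_bounds(1)[OF S]) (use v c in auto)
    also have "\<dots> = - 1" using \<open>\<not> d \<ge> 0\<close> unfolding d by (simp add: t_def field_simps)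
    finally show False by simp
  qed
  then show ?thesis using d[of "c k"] c by simp
qed (simp add: insert_absorb)

lemma mdet_gram_kernel_mono:
  assumes S: "finite S" and v: "\<And>l i. l \<in> J' \<Longrightarrow> real_quat (v l i)"
    and c: "\<And>l. l \<in> J' \<Longrightarrow> 0 \<le> c l" and J: "finite J'" "J \<subseteq> J'"
  shows "mdet (gram_kernel J c v) S \<le> mdet (gram_kernel J' c v) S"
proof -
  have "mdet (gram_kernel J c v) S \<le> mdet (gram_kernel (J \<union> D) c v) S" if "finite D" "D \<subseteq> J'" for D
    using that
  proof (induction D rule: finite_induct)
    case (insert k D)
    have "finite J" using J finite_subset by blast
    then have "mdet (gram_kernel (J \<union> D) c v) S \<le> mdet (gram_kernel (insert k (J \<union> D)) c v) S"
      using insert J by (intro mdet_gram_kernel_insert_mono S) (auto intro: v c)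
    with insert show ?case by simp
  qed simp
  from this[of J'] J show ?thesis by (simp add: Un_absorb1)
qed

text \<open>Interpolation from the vertices of a cube, one coordinate at a time. For coefficients in
  \<open>[0, 1]\<close> the weight of \<open>T\<close> is the probability that exactly the members
  of \<open>T\<close> succeed in independent trials indexed by \<open>J\<close>.\<close>

lemma multiaffine_expansion:
  fixes f :: "('a \<Rightarrow> real) \<Rightarrow> real"
  assumes "finite J"
    and "\<And>k c. k \<in> J \<Longrightarrow> \<exists>b d. \<forall>t. f (c(k := t)) = b + t * d"
  shows "f c = (\<Sum>T\<in>Pow J. (\<Prod>k\<in>J. if k \<in> T then c k else 1 - c k) *
    f (\<lambda>k. if k \<in> J then of_bool (k \<in> T) else c k))"
  using assms
proof (induction J rule: finite_induct)
  case empty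
  then show ?case by simp
next
  case (insert j J)
  \<comment> \<open>The vertex \<open>T\<close> of the cube over \<open>J\<close>, with the new
    coordinate \<open>j\<close> set to \<open>e\<close>; the faces \<open>e = 0\<close> and
    \<open>e = 1\<close> are handled by \<open>notin\<close> and \<open>yes\<close>.\<close>
  define g where "g = (\<lambda>T e k. if k = j then e else if k \<in> J then of_bool (k \<in> T) else c k)"
  define p where "p = (\<lambda>T. \<Prod>k\<in>J. if k \<in> T then c k else 1 - c k)"
  have split: "f (\<lambda>k. if k \<in> J then of_bool (k \<in> T) else c k) = (1 - c j) * f (g T 0) + c j * f (g T 1)" for T
  proof -
    obtain b d where bd: "\<And>t. f ((g T 0)(j := t)) = b + t * d"
      using insert.prems[of j] by blast
    have "(\<lambda>k. if k \<in> J then of_bool (k \<in> T) else c k) = (g T 0)(j := c j)"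
      "g T 0 = (g T 0)(j := 0)" "g T 1 = (g T 0)(j := 1)"
      using insert.hyps by (auto simp: g_def fun_eq_iff)
    then have "f (\<lambda>k. if k \<in> J then of_bool (k \<in> T) else c k) = b + c j * d"
      "f (g T 0) = b" "f (g T 1) = b + d"
      using bd[of "c j"] bd[of 0] bd[of 1] by simp_all
    then show ?thesis by (simp add: algebra_simps)
  qed
  have notin: "(\<Prod>k\<in>insert j J. if k \<in> T then c k else 1 - c k) *
      f (\<lambda>k. if k \<in> insert j J then of_bool (k \<in> T) else c k) = p T * ((1 - c j) * f (g T 0))"
    if "T \<in> Pow J" for T
  proof -
    have j: "j \<notin> T" using that insert.hyps by auto
    then have "(\<lambda>k. if k \<in> insert j J then of_bool (k \<in> T) else c k) = g T 0"
      by (auto simp: g_def fun_eq_iff)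
    then show ?thesis using j insert.hyps by (simp add: p_def)
  qed
  have yes: "(\<Prod>k\<in>insert j J. if k \<in> insert j T then c k else 1 - c k) *
      f (\<lambda>k. if k \<in> insert j J then of_bool (k \<in> insert j T) else c k) = p T * (c j * f (g T 1))"
    if "T \<in> Pow J" for T
  proof -
    have "(\<lambda>k. if k \<in> insert j J then of_bool (k \<in> insert j T) else c k) = g T 1"
      by (auto simp: g_def fun_eq_iff)
    moreover have "(\<Prod>k\<in>J. if k \<in> insert j T then c k else 1 - c k) = p T"
      unfolding p_def using insert.hyps by (intro prod.cong) auto
    ultimately show ?thesis using insert.hyps by simp
  qed
  have inj: "inj_on (insert j) (Pow J)"
    using insert.hyps by (auto simp: inj_on_def)
  have "f c = (\<Sum>T\<in>Pow J. p T * f (\<lambda>k. if k \<in> J then of_bool (k \<in> T) else c k))"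
    unfolding p_def by (rule insert.IH) (use insert.prems in auto)
  also have "\<dots> = (\<Sum>T\<in>Pow J. p T * ((1 - c j) * f (g T 0))) + (\<Sum>T\<in>Pow J. p T * (c j * f (g T 1)))"
    unfolding split by (simp add: distrib_left sum.distrib)
  also have "\<dots> = (\<Sum>T\<in>Pow (insert j J). (\<Prod>k\<in>insert j J. if k \<in> T then c k else 1 - c k) *
      f (\<lambda>k. if k \<in> insert j J then of_bool (k \<in> T) else c k))"
    unfolding Pow_insert using insert.hyps inj
    by (subst sum.union_disjoint) (auto simp: sum.reindex notin[symmetric] yes[symmetric] simp del: prod.insert)
  finally show ?case .
qed

section \<open>Continuity and measurability of the determinant\<close>

lemma bounded_bilinear_cquat_times: "bounded_bilinear ((*) :: cquat \<Rightarrow> cquat \<Rightarrow> cquat)"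
  unfolding bilinear_conv_bounded_bilinear[symmetric] bilinear_def linear_iff
  by (simp add: algebra_simps)

lemma bounded_linear_qconj: "bounded_linear qconj"
  unfolding linear_conv_bounded_linear[symmetric] linear_iff by simp

lemma bounded_linear_qre: "bounded_linear qre"
  unfolding linear_conv_bounded_linear[symmetric] linear_iff by simp

text \<open>Continuity of the product rests on bilinearity in finite dimension: the Euclidean norm
  of complexified quaternions is not submultiplicative.\<close>

lemma tendsto_cquat_times:
  fixes f g :: "'b \<Rightarrow> cquat"
  assumes "(f \<longlongrightarrow> a) F" "(g \<longlongrightarrow> b) F"
  shows "((\<lambda>x. f x * g x) \<longlongrightarrow> a * b) F"
  using bounded_bilinear.tendsto[OF bounded_bilinear_cquat_times assms] .

lemma borel_measurable_cquat_times:
  fixes f g :: "'b \<Rightarrow> cquat"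
  assumes "f \<in> borel_measurable M" "g \<in> borel_measurable M"
  shows "(\<lambda>x. f x * g x) \<in> borel_measurable M"
  using assms
  by (rule borel_measurable_continuous_Pair)
    (intro bounded_bilinear.continuous_on[OF bounded_bilinear_cquat_times] continuous_intros)

lemma borel_measurable_bounded_linear:
  assumes "bounded_linear h" "f \<in> borel_measurable M"
  shows "(\<lambda>x. h (f x)) \<in> borel_measurable M"
  using assms by (intro borel_measurable_continuous_on[of h] linear_continuous_on)

lemma tendsto_walk:
  assumes "\<And>i j. i \<in> S \<Longrightarrow> j \<in> S \<Longrightarrow> ((\<lambda>z. X z i j) \<longlongrightarrow> Y i j) F"
    and "a \<in> S" "set l \<subseteq> S" "b \<in> S"
  shows "((\<lambda>z. walk (X z) a l b) \<longlongrightarrow> walk Y a l b) F"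
  using assms(2-) by (induction l arbitrary: a) (auto intro!: tendsto_cquat_times assms(1))

lemma borel_measurable_walk:
  assumes "\<And>i j. i \<in> S \<Longrightarrow> j \<in> S \<Longrightarrow> (\<lambda>z. X z i j) \<in> borel_measurable M"
    and "a \<in> S" "set l \<subseteq> S" "b \<in> S"
  shows "(\<lambda>z. walk (X z) a l b) \<in> borel_measurable M"
  using assms(2-) by (induction l arbitrary: a) (auto intro!: borel_measurable_cquat_times assms(1))

lemma tendsto_mdet:
  assumes "finite S" "\<And>i j. i \<in> S \<Longrightarrow> j \<in> S \<Longrightarrow> ((\<lambda>z. X z i j) \<longlongrightarrow> Y i j) F"
  shows "((\<lambda>z. mdet (X z) S) \<longlongrightarrow> mdet Y S) F"
  using assms
proof (induction "card S" arbitrary: S rule: less_induct)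
  case less
  show ?case
  proof (cases "S = {}")
    case False
    then obtain a T where S: "S = insert a T" "a \<notin> T" by (meson ex_in_conv mk_disjoint_insert)
    then have "finite T" using less.prems by simp
    then have card: "card (T - set l) < card S" for l
      using S card_mono[of T "T - set l"] by (simp add: less_Suc_eq_le)
    have exp: "mdet X S = (\<Sum>l\<in>dlists T. (- 1) ^ length l * qre (walk X a l a) * mdet X (T - set l))" for X
      unfolding S(1) by (rule mdet_expand[OF \<open>finite T\<close> S(2)])
    show ?thesis
      unfolding exp
    proof (intro tendsto_sum tendsto_mult tendsto_const)
      fix l assume l: "l \<in> dlists T"
      show "((\<lambda>z. qre (walk (X z) a l a)) \<longlongrightarrow> qre (walk Y a l a)) F"
        using S(1) dlists_subset[OF l]
        by (intro bounded_linear.tendsto[OF bounded_linear_qre] tendsto_walk[of S] less.prems(2)) auto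
      show "((\<lambda>z. mdet (X z) (T - set l)) \<longlongrightarrow> mdet Y (T - set l)) F"
        using S(1) \<open>finite T\<close> by (intro less.hyps card less.prems(2)) auto
    qed
  qed simp
qed

lemma borel_measurable_mdet:
  assumes "finite S" "\<And>i j. i \<in> S \<Longrightarrow> j \<in> S \<Longrightarrow> (\<lambda>z. X z i j) \<in> borel_measurable M"
  shows "(\<lambda>z. mdet (X z) S) \<in> borel_measurable M"
  using assms
proof (induction "card S" arbitrary: S rule: less_induct)
  case less
  show ?case
  proof (cases "S = {}")
    case False
    then obtain a T where S: "S = insert a T" "a \<notin> T" by (meson ex_in_conv mk_disjoint_insert)
    then have "finite T" using less.prems by simp
    then have card: "card (T - set l) < card S" for l
      using S card_mono[of T "T - set l"] by (simp add: less_Suc_eq_le)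
    have exp: "mdet X S = (\<Sum>l\<in>dlists T. (- 1) ^ length l * qre (walk X a l a) * mdet X (T - set l))" for X
      unfolding S(1) by (rule mdet_expand[OF \<open>finite T\<close> S(2)])
    show ?thesis
      unfolding exp
    proof (intro borel_measurable_sum borel_measurable_times borel_measurable_const)
      fix l assume l: "l \<in> dlists T"
      show "(\<lambda>z. qre (walk (X z) a l a)) \<in> borel_measurable M"
        using S(1) dlists_subset[OF l]
        by (intro borel_measurable_bounded_linear[OF bounded_linear_qre] borel_measurable_walk[of S]
            less.prems(2)) auto
      show "(\<lambda>z. mdet (X z) (T - set l)) \<in> borel_measurable M"
        using S(1) \<open>finite T\<close> by (intro less.hyps card less.prems(2)) auto
    qed
  qed simp
qed

section \<open>Measurability of point counts\<close>

lemma num_points_cases: "num_points c A = \<infinity> \<or> (\<exists>n::nat. num_points c A = of_nat n)"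
proof (cases "finite {x \<in> A. c x \<noteq> 0}")
  case True
  have "num_points c A = (\<Sum>x | x \<in> A \<and> c x \<noteq> 0. of_nat (c x))"
    unfolding num_points_def using True
    by (subst nn_integral_count_space) auto
  also have "\<dots> = of_nat (\<Sum>x | x \<in> A \<and> c x \<noteq> 0. c x)" by simp
  finally show ?thesis by blast
next
  case False
  \<comment> \<open>Infinitely many points of multiplicity at least 1 give an infinite
    count.\<close>
  have "\<infinity> = (\<integral>\<^sup>+x. indicator {x \<in> A. c x \<noteq> 0} x \<partial>count_space A)"
    using False by (subst nn_integral_indicator) auto
  also have "\<dots> \<le> num_points c A"
    unfolding num_points_def
  proof (intro nn_integral_mono)
    fix x
    have "(1 :: ennreal) \<le> of_nat (c x)" if "c x \<noteq> 0"
      using of_nat_mono[of 1 "c x", where 'a = ennreal] that by simp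
    then show "indicator {x \<in> A. c x \<noteq> 0} x \<le> (of_nat (c x) :: ennreal)"
      by (simp add: indicator_def)
  qed
  finally show ?thesis by (simp add: top_unique)
qed

text \<open>The generators prescribe finite counts only. An infinite count is the complement of
  countably many such events, as no other values occur.\<close>

lemma measurable_num_points:
  assumes "A \<in> sets borel"
  shows "(\<lambda>c. num_points c A) \<in> borel_measurable config_space"
proof -
  let ?G = "{{c \<in> configurations. num_points c A = of_nat n} | A n. A \<in> sets borel}"
  have space: "space config_space = configurations" and sets: "sets config_space = sigma_sets configurations ?G"
    unfolding config_space_def by (subst space_measure_of sets_measure_of; force)+
  have fin: "(\<lambda>c. num_points c A) -` {of_nat n} \<inter> space config_space \<in> sets config_space" for n
  proof -
    have "(\<lambda>c. num_points c A) -` {of_nat n} \<inter> space config_space = {c \<in> configurations. num_points c A = of_nat n}"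
      by (auto simp: space)
    also have "\<dots> \<in> sets config_space"
      unfolding sets using assms by (intro sigma_sets.Basic) auto
    finally show ?thesis .
  qed
  have "(\<lambda>c. num_points c A) -` {\<infinity>} \<inter> space config_space =
      space config_space - (\<Union>n. (\<lambda>c. num_points c A) -` {of_nat n} \<inter> space config_space)"
    using num_points_cases[of _ A] by fastforce
  also have "\<dots> \<in> sets config_space" using fin by blast
  finally have "(\<lambda>c. num_points c A) \<in> measurable config_space (count_space (insert \<infinity> (range of_nat)))"
    using num_points_cases[of _ A] fin by (subst measurable_count_space_eq_countable) auto
  then show ?thesis by (rule measurable_compose) simp
qed

lemma measurable_falling_factorials:
  fixes m :: nat
  assumes "\<And>i. i < m \<Longrightarrow> A i \<in> sets borel"
  shows "(\<lambda>c. \<Prod>i<m. \<Prod>j<ks i. num_points c (A i) - of_nat j) \<in> borel_measurable config_space"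
  using assms
  by (intro borel_measurable_prod_ennreal borel_measurable_minus_ennreal measurable_num_points) auto

text \<open>Unconditional sums can thus be computed along a sequence of initial segments, as
  monotone convergence requires.\<close>

lemma filterlim_Int_lessThan:
  "filterlim (\<lambda>N. I \<inter> {..<N}) (finite_subsets_at_top (I :: nat set)) sequentially"
  unfolding filterlim_iff eventually_finite_subsets_at_top
proof (intro allI impI, elim exE conjE)
  fix P X assume X: "finite X" "X \<subseteq> I" "\<forall>Y. finite Y \<and> X \<subseteq> Y \<and> Y \<subseteq> I \<longrightarrow> P Y"
  obtain n where n: "\<forall>x\<in>X. x < n" using X(1) finite_nat_set_iff_bounded by blast
  then have "P (I \<inter> {..<N})" if "N \<ge> n" for N
    using X that by (intro X(3)[rule_format]) force
  then show "\<forall>\<^sub>F N in sequentially. P (I \<inter> {..<N})"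
    unfolding eventually_sequentially by blast
qed

section \<open>Reality and self-duality of infinite diagonal sums\<close>

lemma real_quat_infsum:
  assumes "\<And>k. k \<in> I \<Longrightarrow> real_quat (f k)"
  shows "real_quat (infsum f I)"
proof (cases "f summable_on I")
  case True
  \<comment> \<open>The imaginary part of a coordinate is a bounded linear functional, so it
    commutes with the convergent sum.\<close>
  have comp: "Im (h (infsum f I)) = 0" if "linear h" "\<And>k. k \<in> I \<Longrightarrow> Im (h (f k)) = 0" for h :: "cquat \<Rightarrow> complex"
  proof -
    have bl: "bounded_linear (\<lambda>q. Im (h q))"
      using bounded_linear_compose[OF bounded_linear_Im] that(1) linear_conv_bounded_linear by blast
    have "Im (h (infsum f I)) = infsum (\<lambda>k. Im (h (f k))) I"
      by (rule infsum_bounded_linear_strong[symmetric])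
        (use summable_on_bounded_linear[OF bl True] True bl in auto)
    also have "\<dots> = 0" using that(2) by (intro infsum_0)
    finally show ?thesis .
  qed
  show ?thesis
    unfolding real_quat_iff using assms
    by (intro conjI comp[of cq_s] comp[of cq_x] comp[of cq_y] comp[of cq_z])
      (auto simp: linear_iff real_quat_iff)
qed (simp add: infsum_not_exists)

text \<open>Conjugation is its own bounded linear inverse, so it preserves divergence as well as
  convergence, and divergent sums have the value 0 on both sides.\<close>

lemma qconj_infsum: "qconj (infsum f I) = infsum (\<lambda>k. qconj (f k)) I"
  by (rule infsum_bounded_linear_strong[symmetric])
    (use summable_on_bounded_linear_iff[OF bounded_linear_qconj bounded_linear_qconj] bounded_linear_qconj in auto)

lemma self_dual_diagonal_kernel: "self_dual_kernel (diagonal_kernel I c u)"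
  by (simp add: self_dual_kernel_def diagonal_kernel_def qconj_infsum qconj_mult)

lemma real_selfdual_diagonal_kernel:
  assumes "\<And>k x. k \<in> I \<Longrightarrow> real_quat (u k x)"
  shows "real_selfdual (\<lambda>i j. diagonal_kernel I c u (x i) (x j))"
proof (rule real_selfdualI)
  show "real_quat (diagonal_kernel I c u (x i) (x j))" for i j
    unfolding diagonal_kernel_def by (intro real_quat_infsum) (simp add: assms)
  show "qconj (diagonal_kernel I c u (x i) (x j)) = diagonal_kernel I c u (x j) (x i)" for i j
    using self_dual_diagonal_kernel[of I c u] unfolding self_dual_kernel_def by metis
qed


section \<open>Mixtures\<close>

lemma (in product_sigma_finite) AE_PiM_component_finite:
  assumes "finite J" "i \<in> J" "N \<in> null_sets (M i)"
  shows "AE x in PiM J M. x i \<notin> N"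
proof (rule AE_I)
  let ?A = "PiE J (\<lambda>j. if j = i then N else space (M j))"
  have N: "N \<in> sets (M i)" "emeasure (M i) N = 0" using assms(3) by auto
  show "{x \<in> space (PiM J M). \<not> x i \<notin> N} \<subseteq> ?A"
    by (auto simp: space_PiM PiE_def extensional_def)
  show "?A \<in> sets (PiM J M)"
    using assms N by (intro sets_PiM_I_finite) auto
  have "emeasure (PiM J M) ?A = (\<Prod>j\<in>J. emeasure (M j) (if j = i then N else space (M j)))"
    using assms N by (intro emeasure_PiM) auto
  \<comment> \<open>The factor for \<open>i\<close> is 0, and in \<open>ennreal\<close> it
    annihilates infinite factors too.\<close>
  also have "\<dots> = 0" using assms N by (intro prod_zero) auto
  finally show "emeasure (PiM J M) ?A = 0" .
qed

text \<open>Expanded over the vertices of the cube, \<open>f\<close> is a combination of products of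
  independent factors. The expectation passes to these factors, and the same expansion read
  backwards at \<open>lam\<close> gives \<open>f lam\<close>.\<close>

lemma (in prob_space) expectation_multiaffine_Bernoulli:
  fixes f :: "('i \<Rightarrow> real) \<Rightarrow> real"
  assumes J: "finite J" "J \<subseteq> I"
    and indep: "indep_vars (\<lambda>_. count_space UNIV) \<xi> I"
    and lam: "\<And>k. k \<in> J \<Longrightarrow> lam k \<in> {0..1}"
    and distr: "\<And>k. k \<in> J \<Longrightarrow> distr M (count_space UNIV) (\<xi> k) = measure_pmf (bernoulli_pmf (lam k))"
    and affine: "\<And>k c. k \<in> J \<Longrightarrow> \<exists>b d. \<forall>t. f (c(k := t)) = b + t * d"
    and dep: "\<And>c c'. (\<And>k. k \<in> J \<Longrightarrow> c k = c' k) \<Longrightarrow> f c = f c'"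
  shows "has_bochner_integral M (\<lambda>\<omega>. f (\<lambda>k. of_bool (\<xi> k \<omega>))) (f lam)"
proof -
  \<comment> \<open>One factor of the vertex weight: the indicator of success for
    \<open>k \<in> T\<close>, of failure otherwise.\<close>
  define Y :: "'i set \<Rightarrow> 'i \<Rightarrow> bool \<Rightarrow> real"
    where "Y = (\<lambda>T k b. if k \<in> T then of_bool b else 1 - of_bool b)"
  define h where "h = (\<lambda>T. f (\<lambda>k. of_bool (k \<in> T)))"
  have f: "f c = (\<Sum>T\<in>Pow J. (\<Prod>k\<in>J. if k \<in> T then c k else 1 - c k) * h T)" for c
  proof -
    have "f (\<lambda>k. if k \<in> J then of_bool (k \<in> T) else c k) = h T" for T
      unfolding h_def by (rule dep) simp
    then show ?thesis
      using multiaffine_expansion[OF J(1) affine, of c] by simp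
  qed
  have rv: "random_variable (count_space UNIV) (\<xi> k)" if "k \<in> J" for k
    using indep J that by (auto simp: indep_vars_def)
  have Y_indep: "indep_vars (\<lambda>_. borel) (\<lambda>k \<omega>. Y T k (\<xi> k \<omega>)) J" for T
    by (rule indep_vars_compose2[OF indep_vars_subset[OF indep J(2)]]) simp
  have Y_int: "integrable M (\<lambda>\<omega>. Y T k (\<xi> k \<omega>))" if "k \<in> J" for T k
  proof (rule integrable_const_bound[where B = 1])
    show "(\<lambda>\<omega>. Y T k (\<xi> k \<omega>)) \<in> borel_measurable M"
      by (rule measurable_compose[OF rv[OF that]]) simp
  qed (auto simp: Y_def)
  have Y_exp: "expectation (\<lambda>\<omega>. Y T k (\<xi> k \<omega>)) = (if k \<in> T then lam k else 1 - lam k)" if "k \<in> J" for T k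
  proof -
    have "expectation (\<lambda>\<omega>. Y T k (\<xi> k \<omega>)) = (\<integral>b. Y T k b \<partial>distr M (count_space UNIV) (\<xi> k))"
      by (subst integral_distr[OF rv[OF that]]) auto
    also have "\<dots> = (if k \<in> T then lam k else 1 - lam k)"
      using lam[OF that] by (simp add: distr[OF that] Y_def)
    finally show ?thesis .
  qed
  have "has_bochner_integral M (\<lambda>\<omega>. \<Prod>k\<in>J. Y T k (\<xi> k \<omega>)) (\<Prod>k\<in>J. if k \<in> T then lam k else 1 - lam k)" for T
    using indep_vars_integrable[OF J(1) Y_indep Y_int, of T]
      indep_vars_lebesgue_integral[OF J(1) Y_indep Y_int, of T] Y_exp
    by (simp add: has_bochner_integral_iff)
  then have "has_bochner_integral M (\<lambda>\<omega>. \<Sum>T\<in>Pow J. (\<Prod>k\<in>J. Y T k (\<xi> k \<omega>)) * h T)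
      (\<Sum>T\<in>Pow J. (\<Prod>k\<in>J. if k \<in> T then lam k else 1 - lam k) * h T)"
    by (intro has_bochner_integral_sum has_bochner_integral_mult_left)
  then show ?thesis
    unfolding f[of lam, symmetric] unfolding Y_def f[of "\<lambda>k. of_bool (\<xi> k _)", symmetric] .
qed

text \<open>The first Borel-Cantelli lemma applies because the success probabilities are summable.
  Hence the random kernel is almost surely a finite sum.\<close>

lemma (in prob_space) AE_finite_Bernoulli_successes:
  fixes I :: "nat set"
  assumes indep: "indep_vars (\<lambda>_. count_space UNIV) \<xi> I"
    and lam: "\<And>k. k \<in> I \<Longrightarrow> lam k \<in> {0..1}"
    and distr: "\<And>k. k \<in> I \<Longrightarrow> distr M (count_space UNIV) (\<xi> k) = measure_pmf (bernoulli_pmf (lam k))"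
    and summable: "lam summable_on I"
  shows "AE \<omega> in M. finite {k \<in> I. \<xi> k \<omega>}"
proof -
  define A where "A = (\<lambda>k. if k \<in> I then {\<omega> \<in> space M. \<xi> k \<omega>} else {})"
  have rv: "random_variable (count_space UNIV) (\<xi> k)" if "k \<in> I" for k
    using indep that by (auto simp: indep_vars_def)
  have A: "A k \<in> events" for k
    using rv[of k] by (cases "k \<in> I") (auto simp: A_def)
  have "prob (A k) = (if k \<in> I then lam k else 0)" for k
  proof (cases "k \<in> I")
    case True
    have "prob (A k) = measure (distr M (count_space UNIV) (\<xi> k)) {True}"
      using True by (subst measure_distr[OF rv[OF True]]) (auto simp: A_def intro!: arg_cong[where f = prob])
    then show ?thesis using lam[OF True] True by (simp add: distr[OF True] measure_pmf_single)
  qed (simp add: A_def)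
  moreover have "(\<lambda>k. if k \<in> I then lam k else 0) summable_on UNIV"
    using summable by (subst summable_on_cong_neutral[where T = I and g = lam]) auto
  ultimately have "summable (\<lambda>k. prob (A k))"
    using summable_on_imp_summable by simp
  then have "AE \<omega> in M. eventually (\<lambda>n. \<omega> \<in> space M - A n) sequentially"
    using A by (intro borel_cantelli_AE1) (auto simp: less_top[symmetric])
  then show ?thesis
  proof eventually_elim
    case (elim \<omega>)
    then obtain n where n: "\<And>k. k \<ge> n \<Longrightarrow> \<omega> \<in> space M - A k"
      by (auto simp: eventually_sequentially)
    have "k < n" if "k \<in> I" "\<xi> k \<omega>" for k
      using n[of k] that by (cases "k < n") (auto simp: A_def)
    then have "{k \<in> I. \<xi> k \<omega>} \<subseteq> {..<n}" by auto
    then show ?case using finite_subset by blast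
  qed
qed

section \<open>Determinants of truncated kernels\<close>

definition truncation ::
  "nat set \<Rightarrow> (nat \<Rightarrow> 'a \<Rightarrow> cquat) \<Rightarrow> nat \<Rightarrow> nat \<Rightarrow> (nat \<Rightarrow> real) \<Rightarrow> (nat \<Rightarrow> 'a) \<Rightarrow> real" where
  "truncation I u m N c x = mdet (gram_kernel (I \<inter> {..<N}) c (\<lambda>k i. u k (x i))) {..<m}"

lemma truncation_nonneg:
  assumes "\<And>k x. k \<in> I \<Longrightarrow> real_quat (u k x)" "\<And>k. k \<in> I \<Longrightarrow> 0 \<le> c k"
  shows "0 \<le> truncation I u m N c x"
  unfolding truncation_def using assms by (intro mdet_gram_kernel_bounds(1)) auto

lemma truncation_mono:
  assumes "\<And>k x. k \<in> I \<Longrightarrow> real_quat (u k x)" "\<And>k. k \<in> I \<Longrightarrow> 0 \<le> c k" "N \<le> N'"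
  shows "truncation I u m N c x \<le> truncation I u m N' c x"
  unfolding truncation_def using assms by (intro mdet_gram_kernel_mono) auto

lemma SUP_truncation:
  assumes u: "\<And>k x. k \<in> I \<Longrightarrow> real_quat (u k x)" and c: "\<And>k. k \<in> I \<Longrightarrow> 0 \<le> c k"
    and lim: "(\<lambda>N. truncation I u m N c x) \<longlonglongrightarrow> L"
  shows "(SUP N. ennreal (truncation I u m N c x)) = ennreal L"
proof (rule LIMSEQ_unique)
  show "(\<lambda>N. ennreal (truncation I u m N c x)) \<longlonglongrightarrow> (SUP N. ennreal (truncation I u m N c x))"
    by (intro LIMSEQ_SUP monoI ennreal_leI truncation_mono u c)
  show "(\<lambda>N. ennreal (truncation I u m N c x)) \<longlonglongrightarrow> ennreal L"
    using lim by (intro tendsto_ennrealI)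
qed

lemma truncation_tendsto:
  assumes "\<And>i j. i < m \<Longrightarrow> j < m \<Longrightarrow> (\<lambda>k. c k *\<^sub>R (u k (x i) * qconj (u k (x j)))) summable_on I"
  shows "(\<lambda>N. truncation I u m N c x) \<longlonglongrightarrow> mdet (\<lambda>i j. diagonal_kernel I c u (x i) (x j)) {..<m}"
  unfolding truncation_def
proof (rule tendsto_mdet)
  fix i j assume ij: "i \<in> {..<m}" "j \<in> {..<m}"
  let ?f = "\<lambda>k. c k *\<^sub>R (u k (x i) * qconj (u k (x j)))"
  have "(?f has_sum diagonal_kernel I c u (x i) (x j)) I"
    unfolding diagonal_kernel_def using assms ij by (intro has_sum_infsum) auto
  then have "(sum ?f \<longlongrightarrow> diagonal_kernel I c u (x i) (x j)) (finite_subsets_at_top I)"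
    by (simp add: has_sum_def)
  from filterlim_compose[OF this filterlim_Int_lessThan]
  show "(\<lambda>N. gram_kernel (I \<inter> {..<N}) c (\<lambda>k i. u k (x i)) i j) \<longlonglongrightarrow> diagonal_kernel I c u (x i) (x j)"
    by (simp add: gram_kernel_def)
qed simp

lemma borel_measurable_truncation:
  assumes c: "\<And>k. k \<in> I \<Longrightarrow> (\<lambda>z. c z k) \<in> borel_measurable M"
    and u: "\<And>k i. k \<in> I \<Longrightarrow> i < m \<Longrightarrow> (\<lambda>z. u k (x z i)) \<in> borel_measurable M"
  shows "(\<lambda>z. truncation I u m N (c z) (x z)) \<in> borel_measurable M"
  unfolding truncation_def gram_kernel_def using assms
  by (intro borel_measurable_mdet borel_measurable_sum borel_measurable_scaleR borel_measurable_cquat_times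
      borel_measurable_bounded_linear[OF bounded_linear_qconj]) auto

text \<open>The truncated determinant depends on finitely many coefficients and is affine in each,
  so averaging over independent coefficients replaces them by their means.\<close>

lemma (in prob_space) nn_integral_truncation:
  assumes u: "\<And>k x. k \<in> I \<Longrightarrow> real_quat (u k x)"
    and indep: "indep_vars (\<lambda>_. count_space UNIV) \<xi> I"
    and lam: "\<And>k. k \<in> I \<Longrightarrow> lam k \<in> {0..1}"
    and distr: "\<And>k. k \<in> I \<Longrightarrow> distr M (count_space UNIV) (\<xi> k) = measure_pmf (bernoulli_pmf (lam k))"
  shows "(\<integral>\<^sup>+\<omega>. ennreal (truncation I u m N (\<lambda>k. of_bool (\<xi> k \<omega>)) x) \<partial>M) = ennreal (truncation I u m N lam x)"
proof -
  let ?J = "I \<inter> {..<N}"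
  have aff: "\<exists>b d. \<forall>t. truncation I u m N (c(k := t)) x = b + t * d" if k: "k \<in> ?J" for k c
  proof -
    obtain d where "\<And>t. mdet (gram_kernel ?J (c(k := t)) (\<lambda>k i. u k (x i))) {..<m} =
        mdet (gram_kernel (?J - {k}) c (\<lambda>k i. u k (x i))) {..<m} + t * d"
      by (rule mdet_gram_kernel_affine[of "{..<m}" ?J "\<lambda>k i. u k (x i)" k c]) (use k u in auto)
    then show ?thesis unfolding truncation_def by blast
  qed
  have dep: "truncation I u m N c x = truncation I u m N c' x" if "\<And>k. k \<in> ?J \<Longrightarrow> c k = c' k" for c c'
  proof -
    have "gram_kernel ?J c (\<lambda>k i. u k (x i)) = gram_kernel ?J c' (\<lambda>k i. u k (x i))"
      unfolding gram_kernel_def by (intro ext sum.cong) (use that in auto)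
    then show ?thesis by (simp add: truncation_def)
  qed
  have "has_bochner_integral M (\<lambda>\<omega>. truncation I u m N (\<lambda>k. of_bool (\<xi> k \<omega>)) x) (truncation I u m N lam x)"
  proof (rule expectation_multiaffine_Bernoulli[of ?J I \<xi> lam "\<lambda>c. truncation I u m N c x", OF _ _ indep])
    show "lam k \<in> {0..1}" "distr M (count_space UNIV) (\<xi> k) = measure_pmf (bernoulli_pmf (lam k))"
      if "k \<in> ?J" for k
      using that lam distr by auto
  qed (fact aff dep | simp)+
  moreover have "0 \<le> truncation I u m N (\<lambda>k. of_bool (\<xi> k \<omega>)) x" for \<omega>
    by (rule truncation_nonneg) (auto simp: u)
  ultimately show ?thesis
    by (subst nn_integral_eq_integral) (auto simp: has_bochner_integral_iff)
qed


text \<open>With finitely many successes the series is a finite sum at every point, so no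
  exceptional null set arises.\<close>

lemma SUP_truncation_finite:
  assumes u: "\<And>k x. k \<in> I \<Longrightarrow> real_quat (u k x)" and fin: "finite {k \<in> I. b k}"
  shows "(SUP N. ennreal (truncation I u m N (\<lambda>k. of_bool (b k)) x)) =
    ennreal (mdet (\<lambda>i j. diagonal_kernel I (\<lambda>k. of_bool (b k)) u (x i) (x j)) {..<m})"
proof (intro SUP_truncation u truncation_tendsto)
  fix i j
  let ?f = "\<lambda>k. of_bool (b k) *\<^sub>R (u k (x i) * qconj (u k (x j)))"
  have "?f summable_on {k \<in> I. b k}" using fin by simp
  then show "?f summable_on I"
    by (subst summable_on_cong_neutral[where T = "{k \<in> I. b k}" and g = ?f]) auto
qed auto

text \<open>Hadamard's inequality bounds the determinant by a product over the points, whose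
  integral factorizes. By orthonormality each factor integrates to a partial sum of the eigenvalues,
  and the resulting bound is uniform in \<open>N\<close>.\<close>

lemma nn_integral_truncation_le:
  assumes "sigma_finite_measure \<mu>" and form: "real_diagonal_form \<mu> I lam u K"
    and lam: "\<And>k. k \<in> I \<Longrightarrow> 0 \<le> lam k" and summable: "lam summable_on I"
  shows "(\<integral>\<^sup>+x. ennreal (truncation I u m N lam x) \<partial>Pi\<^sub>M {..<m} (\<lambda>_. \<mu>)) \<le> ennreal (infsum lam I) ^ m"
proof -
  interpret sigma_finite_measure \<mu> by fact
  interpret product_sigma_finite "\<lambda>_::nat. \<mu>" by standard
  let ?J = "I \<inter> {..<N}"
  define g where "g = (\<lambda>y. \<Sum>k\<in>?J. lam k * (norm (u k y))\<^sup>2)"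
  have u: "\<And>k x. k \<in> I \<Longrightarrow> real_quat (u k x)"
    and "\<forall>k\<in>I. \<forall>l\<in>I. has_bochner_integral \<mu> (\<lambda>x. qconj (u k x) * u l x) (if k = l then 1 else 0)"
    using form unfolding real_diagonal_form_def by blast+
  then have ortho: "has_bochner_integral \<mu> (\<lambda>x. qconj (u k x) * u k x) 1" if "k \<in> I" for k
    using that by fastforce
  have g: "has_bochner_integral \<mu> g (\<Sum>k\<in>?J. lam k)"
  proof -
    have "has_bochner_integral \<mu> (\<lambda>y. (norm (u k y))\<^sup>2) 1" if "k \<in> I" for k
    proof -
      have "has_bochner_integral \<mu> (\<lambda>y. qre (qconj (u k y) * u k y)) (qre 1)"
        by (rule has_bochner_integral_bounded_linear[OF bounded_linear_qre ortho[OF that]])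
      then show ?thesis
        using u[OF that] by (simp add: qre_commute[of "qconj _"] qre_mult_qconj) (simp add: qre_def)
    qed
    then have "has_bochner_integral \<mu> g (\<Sum>k\<in>?J. lam k * 1)"
      unfolding g_def by (intro has_bochner_integral_sum has_bochner_integral_mult_right) auto
    then show ?thesis by simp
  qed
  have g0: "0 \<le> g y" for y unfolding g_def using lam by (intro sum_nonneg) auto
  have "(\<integral>\<^sup>+x. ennreal (truncation I u m N lam x) \<partial>Pi\<^sub>M {..<m} (\<lambda>_. \<mu>)) \<le>
      (\<integral>\<^sup>+x. (\<Prod>i<m. ennreal (g (x i))) \<partial>Pi\<^sub>M {..<m} (\<lambda>_. \<mu>))"
  proof (intro nn_integral_mono)
    fix x
    have "truncation I u m N lam x \<le> (\<Prod>i<m. g (x i))"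
      unfolding truncation_def g_def using u lam by (intro mdet_gram_kernel_bounds(2)) auto
    then show "ennreal (truncation I u m N lam x) \<le> (\<Prod>i<m. ennreal (g (x i)))"
      using g0 by (simp add: prod_ennreal ennreal_leI)
  qed
  also have "\<dots> = (\<Prod>i<m. \<integral>\<^sup>+y. ennreal (g y) \<partial>\<mu>)"
    using g by (intro product_nn_integral_prod) (auto simp: has_bochner_integral_iff)
  also have "(\<integral>\<^sup>+y. ennreal (g y) \<partial>\<mu>) = ennreal (\<Sum>k\<in>?J. lam k)"
    using g g0 by (subst nn_integral_eq_integral) (auto simp: has_bochner_integral_iff)
  also have "(\<Prod>i<m. ennreal (\<Sum>k\<in>?J. lam k)) \<le> (\<Prod>i<m. ennreal (infsum lam I))"
    using lam summable by (intro prod_mono_ennreal ennreal_leI finite_sum_le_infsum) auto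
  finally show ?thesis by simp
qed

text \<open>The density is the determinant of \<open>K\<close>, set to 0 where the series may
  diverge, which makes it measurable and nonnegative everywhere. Monotone convergence with the
  uniform bound on the truncations makes it integrable.\<close>

lemma diagonal_kernel_correlation_density:
  assumes sf: "sigma_finite_measure \<mu>" and form: "real_diagonal_form \<mu> I lam u K"
    and lam: "\<And>k. k \<in> I \<Longrightarrow> 0 \<le> lam k" and summable: "lam summable_on I"
  obtains R where "integrable (Pi\<^sub>M {..<m} (\<lambda>_. \<mu>)) R" "\<And>x. 0 \<le> R x"
    "AE x in Pi\<^sub>M {..<m} (\<lambda>_. \<mu>). (SUP N. ennreal (truncation I u m N lam x)) = ennreal (R x)"
    "AE x in Pi\<^sub>M {..<m} (\<lambda>_. \<mu>). of_real (R x) = Det_M m (\<lambda>i j. K (x i) (x j))"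
proof -
  interpret sigma_finite_measure \<mu> by fact
  interpret product_sigma_finite "\<lambda>_::nat. \<mu>" by standard
  let ?M = "Pi\<^sub>M {..<m} (\<lambda>_. \<mu>)"
  have u: "\<And>k x. k \<in> I \<Longrightarrow> real_quat (u k x)" and um: "\<And>k. k \<in> I \<Longrightarrow> u k \<in> borel_measurable \<mu>"
    and K: "K = diagonal_kernel I lam u"
    using form unfolding real_diagonal_form_def by blast+
  obtain N0 where N0: "N0 \<in> null_sets \<mu>" "\<And>x y. x \<notin> N0 \<Longrightarrow> y \<notin> N0 \<Longrightarrow>
      (\<lambda>k. norm (lam k *\<^sub>R (u k x * qconj (u k y)))) summable_on I"
    using form unfolding real_diagonal_form_def by blast
  \<comment> \<open>On \<open>G\<close> the series converges for all pairs of coordinates, including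
    the diagonal ones.\<close>
  define G where "G = {x \<in> space ?M. \<forall>i\<in>{..<m}. x i \<notin> N0}"
  define D where "D = (\<lambda>x. mdet (\<lambda>i j. K (x i) (x j)) {..<m})"
  define R where "R = (\<lambda>x. indicator G x * D x)"
  have trunc_meas: "truncation I u m N lam \<in> borel_measurable ?M" for N
    using um by (intro borel_measurable_truncation[where x = "\<lambda>z. z"])
      (auto intro: measurable_compose[OF measurable_component_singleton])
  have lim: "(\<lambda>N. truncation I u m N lam x) \<longlonglongrightarrow> D x" if "x \<in> G" for x
    unfolding D_def K
  proof (rule truncation_tendsto)
    fix i j assume "i < m" "j < m"
    then show "(\<lambda>k. lam k *\<^sub>R (u k (x i) * qconj (u k (x j)))) summable_on I"
      using that by (intro abs_summable_summable[OF N0(2)]) (auto simp: G_def)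
  qed
  have G_sets: "G \<in> sets ?M"
    unfolding G_def
  proof (rule sets.sets_Collect_finite_All)
    fix i assume i: "i \<in> {..<m}"
    have "(\<lambda>x. x i) -` (space \<mu> - N0) \<inter> space ?M \<in> sets ?M"
      using N0(1) i by (intro measurable_sets[OF measurable_component_singleton]) auto
    also have "(\<lambda>x. x i) -` (space \<mu> - N0) \<inter> space ?M = {x \<in> space ?M. x i \<notin> N0}"
      using i by (auto simp: space_PiM)
    finally show "{x \<in> space ?M. x i \<notin> N0} \<in> sets ?M" .
  qed simp
  have AE_G: "AE x in ?M. x \<in> G"
  proof -
    have "AE x in ?M. \<forall>i\<in>{..<m}. x i \<notin> N0"
      using N0(1) by (intro AE_finite_allI AE_PiM_component_finite) auto
    then show ?thesis using AE_space by eventually_elim (simp add: G_def)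
  qed
  \<comment> \<open>The factor \<open>indicator G\<close> turns convergence on \<open>G\<close> into
    convergence at every point.\<close>
  have R_meas: "R \<in> borel_measurable ?M"
  proof (rule borel_measurable_LIMSEQ_real)
    show "(\<lambda>x. indicator G x * truncation I u m N lam x) \<in> borel_measurable ?M" for N
      using trunc_meas G_sets by measurable
    show "(\<lambda>N. indicator G x * truncation I u m N lam x) \<longlonglongrightarrow> R x" for x
      using lim[of x] by (cases "x \<in> G") (auto simp: R_def)
  qed
  have R0: "0 \<le> R x" for x
  proof (cases "x \<in> G")
    case True
    have "0 \<le> D x"
      by (rule LIMSEQ_le_const[OF lim[OF True]]) (auto intro: truncation_nonneg u lam)
    then show ?thesis by (simp add: R_def)
  qed (simp add: R_def)
  have SUP: "(SUP N. ennreal (truncation I u m N lam x)) = ennreal (R x)" if "x \<in> G" for x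
    using SUP_truncation[where u = u, OF u lam lim[OF that]] that by (simp add: R_def)
  have "(\<integral>\<^sup>+x. ennreal (R x) \<partial>?M) = (\<integral>\<^sup>+x. (SUP N. ennreal (truncation I u m N lam x)) \<partial>?M)"
    by (rule nn_integral_cong_AE, rule AE_mp[OF AE_G]) (simp add: SUP)
  also have "\<dots> = (SUP N. \<integral>\<^sup>+x. ennreal (truncation I u m N lam x) \<partial>?M)"
    using trunc_meas
    by (intro nn_integral_monotone_convergence_SUP monoI le_funI ennreal_leI truncation_mono u lam) auto
  also have "\<dots> \<le> ennreal (infsum lam I) ^ m"
    by (intro SUP_least nn_integral_truncation_le[OF sf form lam summable])
  also have "\<dots> < \<infinity>" by (simp add: less_top[symmetric] power_eq_top_ennreal)
  finally have "integrable ?M R"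
    using R_meas R0 by (intro integrableI_nonneg) auto
  moreover have "AE x in ?M. (SUP N. ennreal (truncation I u m N lam x)) = ennreal (R x)"
    using AE_G by eventually_elim (rule SUP)
  moreover have "AE x in ?M. of_real (R x) = Det_M m (\<lambda>i j. K (x i) (x j))"
    using AE_G
  proof eventually_elim
    case (elim x)
    have "Det_M m (\<lambda>i j. K (x i) (x j)) = of_real (D x)"
      unfolding D_def K by (intro Det_M_eq_mdet real_selfdual_diagonal_kernel u)
    with elim show ?case by (simp add: R_def)
  qed
  ultimately show ?thesis using R0 that by blast
qed


lemma sets_PiM_block_constraints:
  fixes ks :: "nat \<Rightarrow> nat"
  assumes A: "\<And>i. i < n \<Longrightarrow> A i \<in> sets \<mu>" and m: "(\<Sum>i<n. ks i) = m"
  shows "{x \<in> space (Pi\<^sub>M {..<m} (\<lambda>_. \<mu>)). \<forall>i<n. \<forall>j<ks i. x ((\<Sum>l<i. ks l) + j) \<in> A i}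
    \<in> sets (Pi\<^sub>M {..<m} (\<lambda>_. \<mu>))"
proof -
  let ?M = "Pi\<^sub>M {..<m} (\<lambda>_. \<mu>)"
  have "{x \<in> space ?M. x ((\<Sum>l<i. ks l) + j) \<in> A i} \<in> sets ?M" if "i < n" "j < ks i" for i j
  proof -
    \<comment> \<open>The blocks are consecutive with total length \<open>m\<close>, so every index
      that occurs is below \<open>m\<close>.\<close>
    have "(\<Sum>l<i. ks l) + j < (\<Sum>l<Suc i. ks l)" using that by simp
    also have "\<dots> \<le> (\<Sum>l<n. ks l)" using that by (intro sum_mono2) auto
    finally have "(\<lambda>x. x ((\<Sum>l<i. ks l) + j)) \<in> measurable ?M \<mu>"
      using m by (intro measurable_component_singleton) auto
    from measurable_sets[OF this A[OF that(1)]] show ?thesis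
      by (simp add: vimage_def Int_def conj_commute)
  qed
  then have "{x \<in> space ?M. \<forall>i\<in>{..<n}. \<forall>j\<in>{..<ks i}. x ((\<Sum>l<i. ks l) + j) \<in> A i} \<in> sets ?M"
    by (intro sets.sets_Collect_finite_All) auto
  then show ?thesis by (simp only: Ball_def lessThan_iff)
qed

theorem theorem1p5:
  fixes \<mu> :: "('a :: t2_space) measure"
    and K :: "'a \<Rightarrow> 'a \<Rightarrow> cquat"
    and I :: "nat set"
    and lam :: "nat \<Rightarrow> real"
    and u :: "nat \<Rightarrow> 'a \<Rightarrow> cquat"
    and \<Omega> :: "'w measure"
    and \<xi> :: "nat \<Rightarrow> 'w \<Rightarrow> bool"
    and \<X> :: "(nat \<Rightarrow> bool) \<Rightarrow> ('a \<Rightarrow> nat) measure"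
    and P :: "('a \<Rightarrow> nat) measure"
  assumes "sigma_finite_measure \<mu>" and "sets \<mu> = sets borel"
    and "real_diagonal_form \<mu> I lam u K"
    and "\<And>k. k \<in> I \<Longrightarrow> lam k \<in> {0..1}"
    and "lam summable_on I"
    and "prob_space \<Omega>"
    and "prob_space.indep_vars \<Omega> (\<lambda>_. count_space UNIV) \<xi> I"
    and "\<And>k. k \<in> I \<Longrightarrow> distr \<Omega> (count_space UNIV) (\<xi> k) = measure_pmf (bernoulli_pmf (lam k))"
    and "(\<lambda>\<omega>. \<X> (\<lambda>k. \<xi> k \<omega>)) \<in> measurable \<Omega> (prob_algebra config_space)"
    and "AE \<omega> in \<Omega>. pfaffian_field \<mu> (\<X> (\<lambda>k. \<xi> k \<omega>))
           (diagonal_kernel I (\<lambda>k. of_bool (\<xi> k \<omega>)) u)"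
    and "P = \<Omega> \<bind> (\<lambda>\<omega>. \<X> (\<lambda>k. \<xi> k \<omega>))"
  shows "pfaffian_field \<mu> P K"
proof -
  interpret \<mu>: sigma_finite_measure \<mu> by fact
  interpret \<mu>s: product_sigma_finite "\<lambda>_::nat. \<mu>" by standard
  interpret \<Omega>: prob_space \<Omega> by fact
  note sets_\<mu> = assms(2) and form = assms(3) and lam = assms(4) and summable = assms(5)
    and indep = assms(7) and distr = assms(8) and \<X> = assms(9)
  have u: "\<And>k x. k \<in> I \<Longrightarrow> real_quat (u k x)" and um: "\<And>k. k \<in> I \<Longrightarrow> u k \<in> borel_measurable \<mu>"
    and K: "K = diagonal_kernel I lam u"
    using form unfolding real_diagonal_form_def by blast+
  have lam0: "\<And>k. k \<in> I \<Longrightarrow> 0 \<le> lam k" using lam by auto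
  have \<Omega>_space: "\<Omega> \<in> space (prob_algebra \<Omega>)"
    by (simp add: space_prob_algebra \<Omega>.prob_space_axioms)
  have "random_point_field P"
    unfolding random_point_field_def assms(11)
    using prob_space_bind'[OF \<Omega>_space \<X>] sets_bind'[OF \<Omega>_space \<X>] by blast
  moreover have "self_dual_kernel K"
    unfolding K by (rule self_dual_diagonal_kernel)
  moreover have "\<exists>R. correlation_function \<mu> P m R \<and>
      (AE x in Pi\<^sub>M {..<m} (\<lambda>_. \<mu>). of_real (R x) = Det_M m (\<lambda>i j. K (x i) (x j)))" if "m \<ge> 1" for m
  proof -
    let ?M = "Pi\<^sub>M {..<m} (\<lambda>_. \<mu>)"
    have finite_successes: "AE \<omega> in \<Omega>. finite {k \<in> I. \<xi> k \<omega>}"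
      by (rule \<Omega>.AE_finite_Bernoulli_successes[OF indep lam distr summable])
    interpret M: sigma_finite_measure ?M by (rule \<mu>s.sigma_finite) simp
    interpret \<Omega>M: pair_sigma_finite \<Omega> ?M ..
    obtain R where R: "integrable ?M R" "\<And>x. 0 \<le> R x"
      "AE x in ?M. (SUP N. ennreal (truncation I u m N lam x)) = ennreal (R x)"
      "AE x in ?M. of_real (R x) = Det_M m (\<lambda>i j. K (x i) (x j))"
      using diagonal_kernel_correlation_density[OF assms(1) form lam0 summable] by blast
    define T where "T = (\<lambda>N \<omega> x. truncation I u m N (\<lambda>k. of_bool (\<xi> k \<omega>)) x)"
    \<comment> \<open>\<open>H \<omega>\<close> is almost surely a version of the conditional
      correlation function. The hypothesis supplies such functions for each \<open>\<omega>\<close>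
      separately; the supremum of truncations is jointly measurable in \<open>\<omega>\<close> and
      \<open>x\<close>, as Tonelli's theorem requires.\<close>
    define H where "H = (\<lambda>\<omega> x. SUP N. ennreal (T N \<omega> x))"
    have T_meas: "(\<lambda>z. T N (fst z) (snd z)) \<in> borel_measurable (\<Omega> \<Otimes>\<^sub>M ?M)" for N
      unfolding T_def
    proof (rule borel_measurable_truncation)
      fix k assume k: "k \<in> I"
      then have "\<xi> k \<in> measurable \<Omega> (count_space UNIV)"
        using indep by (auto simp: \<Omega>.indep_vars_def)
      then have "(\<lambda>z. \<xi> k (fst z)) \<in> measurable (\<Omega> \<Otimes>\<^sub>M ?M) (count_space UNIV)" by measurable
      then show "(\<lambda>z. of_bool (\<xi> k (fst z)) :: real) \<in> borel_measurable (\<Omega> \<Otimes>\<^sub>M ?M)"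
        by (rule measurable_compose) simp
      fix i assume "i < m"
      then show "(\<lambda>z. u k (snd z i)) \<in> borel_measurable (\<Omega> \<Otimes>\<^sub>M ?M)"
        by (intro measurable_compose[OF measurable_compose[OF measurable_snd measurable_component_singleton]]
            um k) simp
    qed
    have H_meas: "case_prod H \<in> borel_measurable (\<Omega> \<Otimes>\<^sub>M ?M)"
      unfolding H_def split_def
      by (intro borel_measurable_SUP measurable_compose[OF T_meas]) auto
    have T_meas': "(\<lambda>\<omega>. T N \<omega> x) \<in> borel_measurable \<Omega>" if "x \<in> space ?M" for N x
      using measurable_compose[OF measurable_Pair2'[OF that] T_meas] by simp
    \<comment> \<open>Monotone convergence in \<open>N\<close> carries the truncated mean identity
      over to the supremum, which by \<open>R(3)\<close> is \<open>R x\<close> for almost every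
      \<open>x\<close>.\<close>
    have mean_H: "(\<integral>\<^sup>+\<omega>. H \<omega> x \<partial>\<Omega>) = (SUP N. ennreal (truncation I u m N lam x))" if "x \<in> space ?M" for x
    proof -
      have "(\<integral>\<^sup>+\<omega>. H \<omega> x \<partial>\<Omega>) = (SUP N. \<integral>\<^sup>+\<omega>. ennreal (T N \<omega> x) \<partial>\<Omega>)"
        unfolding H_def
      proof (rule nn_integral_monotone_convergence_SUP)
        show "incseq (\<lambda>N \<omega>. ennreal (T N \<omega> x))"
          unfolding T_def by (intro monoI le_funI ennreal_leI truncation_mono u) auto
      qed (use T_meas'[OF that] in measurable)
      then show ?thesis
        unfolding T_def using \<Omega>.nn_integral_truncation[where u = u, OF u indep lam distr] by simp
    qed
    have "correlation_function \<mu> P m R"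
      unfolding correlation_function_def
    proof (intro conjI allI impI ballI)
      show "R \<in> borel_measurable ?M" using R(1) by simp
      show "0 \<le> R x" for x by (rule R(2))
      \<comment> \<open>Compact sets in a Hausdorff space are closed and hence Borel, so
        integrability on the whole product restricts to them.\<close>
      show "set_integrable ?M (PiE {..<m} (\<lambda>_. C)) R" if "compact C" for C
        unfolding set_integrable_def
        using that sets_\<mu> by (intro integrable_mult_indicator R(1) sets_PiM_I_finite)
          (auto intro: borel_closed compact_imp_closed)
    next
      fix n :: nat and A ks
      assume *: "(\<forall>i<n. A i \<in> sets \<mu>) \<and> disjoint_family_on A {..<n} \<and> (\<Sum>i<n. ks i) = m"
      define \<phi> where "\<phi> = (\<lambda>c. \<Prod>i<n. \<Prod>j<ks i. num_points c (A i) - of_nat j)"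
      define B where "B = {x \<in> space ?M. \<forall>i<n. \<forall>j<ks i. x ((\<Sum>l<i. ks l) + j) \<in> A i}"
      have \<phi>: "\<phi> \<in> borel_measurable config_space"
        unfolding \<phi>_def using * sets_\<mu> by (intro measurable_falling_factorials) auto
      have B: "B \<in> sets ?M"
        unfolding B_def using * by (intro sets_PiM_block_constraints) auto
      \<comment> \<open>Almost surely the conditional field is Pfaffian and there are finitely many
        successes; then \<open>r\<close> and \<open>H \<omega>\<close> both equal the determinant of
        the random kernel almost everywhere.\<close>
      have conditional: "AE \<omega> in \<Omega>. (\<integral>\<^sup>+c. \<phi> c \<partial>\<X> (\<lambda>k. \<xi> k \<omega>)) = (\<integral>\<^sup>+x\<in>B. H \<omega> x \<partial>?M)"
        using assms(10) finite_successes
      proof eventually_elim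
        case (elim \<omega>)
        let ?K = "diagonal_kernel I (\<lambda>k. of_bool (\<xi> k \<omega>)) u"
        obtain r where r: "correlation_function \<mu> (\<X> (\<lambda>k. \<xi> k \<omega>)) m r"
          "AE x in ?M. of_real (r x) = Det_M m (\<lambda>i j. ?K (x i) (x j))"
          using elim(1) \<open>m \<ge> 1\<close> unfolding pfaffian_field_def by blast
        have "(\<integral>\<^sup>+c. \<phi> c \<partial>\<X> (\<lambda>k. \<xi> k \<omega>)) = (\<integral>\<^sup>+x\<in>B. ennreal (r x) \<partial>?M)"
          using r(1) * unfolding correlation_function_def \<phi>_def B_def by blast
        also have "\<dots> = (\<integral>\<^sup>+x\<in>B. H \<omega> x \<partial>?M)"
        proof (rule nn_integral_cong_AE)
          show "AE x in ?M. ennreal (r x) * indicator B x = H \<omega> x * indicator B x"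
            using r(2)
          proof eventually_elim
            case (elim x)
            have "r x = mdet (\<lambda>i j. ?K (x i) (x j)) {..<m}"
              using elim Det_M_eq_mdet[OF real_selfdual_diagonal_kernel[where u = u, OF u]] by simp
            then show ?case
              using SUP_truncation_finite[where u = u, OF u \<open>finite {k \<in> I. \<xi> k \<omega>}\<close>, of m x] by (simp add: H_def T_def)
          qed
        qed
        finally show ?case .
      qed
      \<comment> \<open>Expectation under the mixture averages the conditional expectations;
        Tonelli's theorem then moves the average over \<open>\<omega>\<close> onto the density
        \<open>H\<close>.\<close>
      have "(\<integral>\<^sup>+c. \<phi> c \<partial>P) = (\<integral>\<^sup>+\<omega>. \<integral>\<^sup>+c. \<phi> c \<partial>\<X> (\<lambda>k. \<xi> k \<omega>) \<partial>\<Omega>)"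
        unfolding assms(11) by (rule nn_integral_bind[OF \<phi> measurable_prob_algebraD[OF \<X>]])
      also have "\<dots> = (\<integral>\<^sup>+\<omega>. \<integral>\<^sup>+x. H \<omega> x * indicator B x \<partial>?M \<partial>\<Omega>)"
        by (rule nn_integral_cong_AE[OF conditional])
      also have "\<dots> = (\<integral>\<^sup>+x. \<integral>\<^sup>+\<omega>. H \<omega> x * indicator B x \<partial>\<Omega> \<partial>?M)"
      proof (rule \<Omega>M.Fubini'[symmetric])
        have "(\<lambda>z. indicator B (snd z) :: ennreal) \<in> borel_measurable (\<Omega> \<Otimes>\<^sub>M ?M)"
          using B by (intro measurable_compose[OF measurable_snd] borel_measurable_indicator)
        with H_meas show "(\<lambda>(\<omega>, x). H \<omega> x * indicator B x) \<in> borel_measurable (\<Omega> \<Otimes>\<^sub>M ?M)"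
          by (simp add: split_def borel_measurable_times_ennreal)
      qed
      also have "\<dots> = (\<integral>\<^sup>+x\<in>B. ennreal (R x) \<partial>?M)"
      proof (rule nn_integral_cong_AE)
        show "AE x in ?M. (\<integral>\<^sup>+\<omega>. H \<omega> x * indicator B x \<partial>\<Omega>) = ennreal (R x) * indicator B x"
          using R(3) AE_space
        proof eventually_elim
          case (elim x)
          then show ?case by (cases "x \<in> B") (simp_all add: mean_H)
        qed
      qed
      finally show "(\<integral>\<^sup>+c. (\<Prod>i<n. \<Prod>j<ks i. num_points c (A i) - of_nat j) \<partial>P) =
          (\<integral>\<^sup>+x\<in>{x \<in> space ?M. \<forall>i<n. \<forall>j<ks i. x ((\<Sum>l<i. ks l) + j) \<in> A i}. ennreal (R x) \<partial>?M)"
        unfolding \<phi>_def B_def .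
    qed
    with R(4) show ?thesis by blast
  qed
  ultimately show ?thesis unfolding pfaffian_field_def by blast
qed

end
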